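(* Let $f(n)=\operatorname{cdeg}(\mathbb{Z}_n\times\mathbb{Z}_n)$ for every positive integer $n$, and let $$M=\prod_p\left(1-\frac1p\right)\sum_{a=0}^{\infty}\frac{f(p^a)}{p^a},$$ the product being over all primes $p$. Then, as $x\to\infty$, $$\sum_{n\le x}\operatorname{cdeg}(\mathbb{Z}_n\times\mathbb{Z}_n)=Mx+O(\log^3 x).$$
   Context: For a finite group $G$, let $L(G)$ be the set of all subgroups of $G$ and $C(G)$ the set of all cyclic subgroups of $G$. The cyclicity degree of $G$ is $\operatorname{cdeg}(G)=|C(G)|/|L(G)|$. $\mathbb{Z}_n$ denotes the cyclic group of order $n$. In the sum, $n$ runs over the positive integers not exceeding the real number $x$. In the definition of $M$, the factor for each prime $p$ is the product of $1-\frac1p$ and the full series over $a$. *)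

theory Defs
  imports
    "HOL-Algebra.Elementary_Groups"
    "HOL-Analysis.Infinite_Products"
    "HOL-Computational_Algebra.Primes"
    "HOL-Library.Landau_Symbols"
begin

definition subgroups_of :: "('a, 'b) monoid_scheme \<Rightarrow> 'a set set" where
  "subgroups_of G = {H. subgroup H G}"

definition cyclic_subgroups_of :: "('a, 'b) monoid_scheme \<Rightarrow> 'a set set" where
  "cyclic_subgroups_of G = {H. subgroup H G \<and> cyclic_group (G\<lparr>carrier := H\<rparr>)}"

definition cdeg :: "('a, 'b) monoid_scheme \<Rightarrow> real" where
  "cdeg G = real (card (cyclic_subgroups_of G)) / real (card (subgroups_of G))"

text \<open>Only \<^term>\<open>n > 0\<close> is meaningful here: \<^term>\<open>integer_mod_group 0\<close> is the infinite group
  of integers.\<close>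
definition cdeg_square :: "nat \<Rightarrow> real" where
  "cdeg_square n = cdeg (integer_mod_group n \<times>\<times> integer_mod_group n)"

definition local_factor :: "nat \<Rightarrow> real" where
  "local_factor p = (1 - 1 / real p) * (\<Sum>a. cdeg_square (p ^ a) / real (p ^ a))"

text \<open>The Euler product is taken in increasing order of the primes, as an infinite product over
  all natural numbers whose non-prime factors are 1.\<close>
definition euler_factor :: "nat \<Rightarrow> real" where
  "euler_factor n = (if prime n then local_factor n else 1)"

definition mean_const :: real where
  "mean_const = prodinf euler_factor"

end

theory Submission
  imports Defs "HOL-Number_Theory.Totient" "HOL-Analysis.Harmonic_Numbers"
    "HOL-Algebra.Multiplicative_Group" "HOL-Real_Asymp.Real_Asymp"
begin

text \<open>
  Write \<open>f = cdeg_square = C / L\<close> with \<open>C\<close>, \<open>L\<close> the numbers of cyclic and of all subgroups of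
  \<open>\<int>\<^sub>n \<times> \<int>\<^sub>n\<close>. A cyclic group of order \<open>d\<close> has \<open>\<phi>(d)\<close> generators, so \<open>C(n)\<close> is the sum of
  \<open>J\<^sub>2(d) / \<phi>(d)\<close> over the divisors \<open>d\<close> of \<open>n\<close>; subgroups are lattices between \<open>n\<int>\<^sup>2\<close> and \<open>\<int>\<^sup>2\<close>, and
  counting Hermite normal forms gives \<open>L(n)\<close> as the sum of \<open>gcd(a, b)\<close> over pairs of divisors
  of \<open>n\<close>. Both are multiplicative, with \<open>C(p\<^sup>k\<^sup>+\<^sup>1) = p C(p\<^sup>k) + 2\<close> and
  \<open>L(p\<^sup>k\<^sup>+\<^sup>1) = p L(p\<^sup>k) + 2k + 3\<close>. Hence the multiplicative function \<open>g = \<mu> * f\<close> satisfies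
  \<open>\<bar>g(p\<^sup>k)\<bar> \<le> (2k + 1) / p\<^sup>k\<close>, which gives \<open>\<bar>g(n)\<bar> \<le> d\<^sub>3(n) / n\<close> with \<open>d\<^sub>3\<close> the threefold divisor function,
  and the sum of \<open>d\<^sub>3(n) / n\<close> over \<open>n \<le> N\<close> is at most the cube of the \<open>N\<close>-th harmonic number. Both the
  rounding errors in \<open>\<Sum> g(d) \<lfloor>N / d\<rfloor>\<close> and \<open>N\<close> times the tail of \<open>\<Sum> g(d) / d\<close> (dyadic
  blocks) are therefore \<open>O(ln\<^sup>3 N)\<close>, and \<open>\<Sum> g(d) / d\<close> is the Euler product by absolute convergence.
\<close>

section \<open>Multiplicative functions\<close>

definition multiplicative_fun :: "(nat \<Rightarrow> real) \<Rightarrow> bool" where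
  "multiplicative_fun f \<longleftrightarrow> f 1 = 1 \<and>
     (\<forall>m n. m > 0 \<longrightarrow> n > 0 \<longrightarrow> coprime m n \<longrightarrow> f (m * n) = f m * f n)"

lemma multiplicative_fun_1: "multiplicative_fun f \<Longrightarrow> f (Suc 0) = 1"
  by (simp add: multiplicative_fun_def)

lemma multiplicative_fun_coprime:
  "multiplicative_fun f \<Longrightarrow> m > 0 \<Longrightarrow> n > 0 \<Longrightarrow> coprime m n \<Longrightarrow> f (m * n) = f m * f n"
  by (simp add: multiplicative_fun_def)

text \<open>Splitting off the full power of one prime leaves a smaller cofactor coprime to it.
  Identities and bounds for multiplicative functions thus reduce to prime powers.\<close>

lemma prime_power_coprime_induct [consumes 1, case_names one step]:
  fixes n :: nat
  assumes "n > 0" and "P 1"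
    and step: "\<And>p k m. prime p \<Longrightarrow> k > 0 \<Longrightarrow> m > 0 \<Longrightarrow> \<not> p dvd m \<Longrightarrow> coprime (p ^ k) m \<Longrightarrow> P m \<Longrightarrow> P (p ^ k * m)"
  shows "P n"
  using \<open>n > 0\<close>
proof (induction n rule: less_induct)
  case (less n)
  show ?case
  proof (cases "n = 1")
    case True
    then show ?thesis using \<open>P 1\<close> by simp
  next
    case False
    then obtain p where p: "prime p" "p dvd n"
      using prime_factor_nat by blast
    have nu: "\<not> is_unit p" and n0: "n \<noteq> 0" using p less.prems by auto
    obtain m where m: "n = p ^ multiplicity p n * m" "\<not> p dvd m"
      using multiplicity_decompose'[OF n0 nu] by metis
    have k: "multiplicity p n > 0"
      using p n0 by (simp add: prime_multiplicity_gt_zero_iff)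
    have m0: "m > 0" using m n0 by (cases m) auto
    have "p ^ multiplicity p n > 1"
      using k p(1) one_less_power prime_gt_1_nat by blast
    then have "m < n" using m(1) m0 by (metis mult_less_cancel2 mult_1)
    moreover have "coprime (p ^ multiplicity p n) m"
      using p m by (simp add: prime_imp_coprime)
    ultimately show ?thesis
      using step[OF p(1) k m0 m(2)] less.IH[OF _ m0] m(1) by metis
  qed
qed

lemma multiplicative_fun_eqI:
  assumes "multiplicative_fun f" "multiplicative_fun g" "n > 0"
    and "\<And>p k. prime p \<Longrightarrow> k > 0 \<Longrightarrow> f (p ^ k) = g (p ^ k)"
  shows "f n = g n"
  using \<open>n > 0\<close>
proof (induction n rule: prime_power_coprime_induct)
  case one
  then show ?case using assms by (simp add: multiplicative_fun_def)
next
  case (step p k m)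
  then show ?case using assms
    by (simp add: multiplicative_fun_coprime prime_gt_0_nat)
qed

lemma multiplicative_fun_abs_le:
  assumes "multiplicative_fun f" "multiplicative_fun g" "n > 0"
    and "\<And>p k. prime p \<Longrightarrow> k > 0 \<Longrightarrow> \<bar>f (p ^ k)\<bar> \<le> g (p ^ k)"
  shows "\<bar>f n\<bar> \<le> g n"
  using \<open>n > 0\<close>
proof (induction n rule: prime_power_coprime_induct)
  case one
  then show ?case using assms by (simp add: multiplicative_fun_def)
next
  case (step p k m)
  have "\<bar>f (p ^ k)\<bar> * \<bar>f m\<bar> \<le> g (p ^ k) * g m"
    using step assms(4)[of p k] by (intro mult_mono) auto
  then show ?case using step assms(1,2)
    by (simp add: multiplicative_fun_coprime prime_gt_0_nat abs_mult)
qed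

lemma multiplicative_fun_divide:
  assumes "multiplicative_fun f" "multiplicative_fun g"
  shows "multiplicative_fun (\<lambda>n. f n / g n)"
  using assms by (simp add: multiplicative_fun_def)

lemma multiplicative_fun_of_nat: "multiplicative_fun real"
  by (simp add: multiplicative_fun_def)

lemma multiplicative_fun_totient: "multiplicative_fun (\<lambda>n. real (totient n))"
  by (simp add: multiplicative_fun_def totient_mult_coprime)

section \<open>Divisor sums over coprime products\<close>

lemma bij_betw_divisors_coprime:
  fixes m n :: nat
  assumes "m > 0" "n > 0" "coprime m n"
  shows "bij_betw (\<lambda>(d, e). d * e) ({d. d dvd m} \<times> {e. e dvd n}) {d. d dvd m * n}"
  unfolding bij_betw_def
proof
  show "inj_on (\<lambda>(d, e). d * e) ({d. d dvd m} \<times> {e. e dvd n})"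
  proof (rule inj_onI, clarsimp)
    fix d e d' e' assume *: "d dvd m" "e dvd n" "d' dvd m" "e' dvd n" "d * e = d' * e'"
    then have c: "coprime d e'" "coprime d' e"
      using assms by (meson coprime_divisors)+
    \<comment> \<open>\<open>d\<close> divides \<open>d' * e'\<close> and is coprime to
      \<open>e'\<close>; likewise with the roles exchanged.\<close>
    have "d dvd d'" "d' dvd d"
      using * c by (metis coprime_dvd_mult_left_iff dvd_triv_left)+
    then have "d = d'" by (simp add: dvd_antisym)
    moreover have "d > 0" using * assms by (metis dvd_pos_nat)
    ultimately show "d = d' \<and> e = e'" using * by simp
  qed
  show "(\<lambda>(d, e). d * e) ` ({d. d dvd m} \<times> {e. e dvd n}) = {d. d dvd m * n}"
  proof (intro equalityI subsetI)
    fix x assume "x \<in> {d. d dvd m * n}"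
    then obtain b c where "x = b * c" "b dvd m" "c dvd n"
      by (auto elim: dvd_productE)
    then show "x \<in> (\<lambda>(d, e). d * e) ` ({d. d dvd m} \<times> {e. e dvd n})" by auto
  qed (auto intro: mult_dvd_mono)
qed

lemma sum_divisors_coprime:
  fixes m n :: nat and f :: "nat \<Rightarrow> real"
  assumes "m > 0" "n > 0" "coprime m n"
  shows "(\<Sum>d | d dvd m * n. f d) = (\<Sum>d | d dvd m. \<Sum>e | e dvd n. f (d * e))"
  using sum.reindex_bij_betw[OF bij_betw_divisors_coprime[OF assms], of f]
  by (simp add: sum.cartesian_product case_prod_unfold)

lemma sum_divisors_prime_power:
  fixes f :: "nat \<Rightarrow> real"
  assumes "prime p"
  shows "(\<Sum>d | d dvd p ^ k. f d) = (\<Sum>i\<le>k. f (p ^ i))"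
proof -
  have "{d. d dvd p ^ k} = (\<lambda>i. p ^ i) ` {..k}"
    using divides_primepow_nat[OF assms] by auto
  moreover have "inj_on (\<lambda>i. p ^ i) {..k}"
    using prime_gt_1_nat[OF assms] by (auto intro!: inj_onI)
  ultimately show ?thesis by (simp add: sum.reindex)
qed

lemma multiplicative_fun_divisor_sum:
  assumes "multiplicative_fun f"
  shows "multiplicative_fun (\<lambda>n. \<Sum>d | d dvd n. f d)"
  unfolding multiplicative_fun_def
proof (intro conjI allI impI)
  show "(\<Sum>d | d dvd 1. f d) = 1"
    using assms by (simp add: multiplicative_fun_def)
next
  fix m n :: nat assume *: "m > 0" "n > 0" "coprime m n"
  have "f (d * e) = f d * f e" if "d dvd m" "e dvd n" for d e
    using that * assms by (metis multiplicative_fun_coprime coprime_divisors dvd_pos_nat)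
  then have "(\<Sum>d | d dvd m * n. f d) = (\<Sum>d | d dvd m. \<Sum>e | e dvd n. f d * f e)"
    using * by (simp add: sum_divisors_coprime)
  then show "(\<Sum>d | d dvd m * n. f d) = (\<Sum>d | d dvd m. f d) * (\<Sum>d | d dvd n. f d)"
    by (simp add: sum_product)
qed

lemma gcd_coprime_mult_right:
  fixes x c d :: nat
  assumes "coprime c d"
  shows "gcd x (c * d) = gcd x c * gcd x d"
proof (rule dvd_antisym)
  have "gcd x (c * d) dvd c * d" by simp
  then obtain u v where uv: "gcd x (c * d) = u * v" "u dvd c" "v dvd d"
    by (rule dvd_productE)
  have "u * v dvd x" using uv(1) by (metis gcd_dvd1)
  then have "u dvd gcd x c" "v dvd gcd x d"
    using uv by (auto dest: dvd_mult_left dvd_mult_right)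
  then show "gcd x (c * d) dvd gcd x c * gcd x d"
    using uv by (simp add: mult_dvd_mono)
  have "coprime (gcd x c) (gcd x d)"
    using assms by (meson coprime_divisors gcd_dvd2)
  then show "gcd x c * gcd x d dvd gcd x (c * d)"
    by (simp add: divides_mult mult_dvd_mono)
qed

lemma gcd_mult_coprime:
  fixes a b c d m n :: nat
  assumes "coprime m n" "a dvd m" "c dvd m" "b dvd n" "d dvd n"
  shows "gcd (a * b) (c * d) = gcd a c * gcd b d"
proof -
  have 1: "coprime c d" "coprime a d" "coprime b c"
    using assms coprime_divisors coprime_commute by metis+
  then show ?thesis
    by (simp add: gcd_coprime_mult_right gcd_mult_left_left_cancel gcd_mult_left_right_cancel coprime_commute)
qed

text \<open>Splitting both divisors along \<open>m * n\<close> also factors the gcd, so the fourfold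
  sum separates. For positive \<open>n\<close> this sum turns out to count the subgroups of
  \<open>Z_square n\<close>.\<close>

lemma multiplicative_fun_gcd_sum:
  "multiplicative_fun (\<lambda>n. \<Sum>a | a dvd n. \<Sum>b | b dvd n. real (gcd a b))"
  unfolding multiplicative_fun_def
proof (intro conjI allI impI)
  fix m n :: nat assume *: "m > 0" "n > 0" "coprime m n"
  let ?S = "\<lambda>n. \<Sum>a | a dvd n. \<Sum>b | b dvd n. real (gcd a b)"
  have "?S (m * n) = (\<Sum>a | a dvd m. \<Sum>b | b dvd n. \<Sum>c | c dvd m. \<Sum>d | d dvd n. real (gcd (a * b) (c * d)))"
    using * by (simp add: sum_divisors_coprime)
  also have "\<dots> = (\<Sum>a | a dvd m. \<Sum>b | b dvd n. \<Sum>c | c dvd m. \<Sum>d | d dvd n. real (gcd a c) * real (gcd b d))"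
    using * by (intro sum.cong refl) (simp add: gcd_mult_coprime[of m n])
  also have "\<dots> = (\<Sum>a | a dvd m. \<Sum>b | b dvd n. (\<Sum>c | c dvd m. real (gcd a c)) * (\<Sum>d | d dvd n. real (gcd b d)))"
    by (simp add: sum_product)
  also have "\<dots> = ?S m * ?S n"
    by (simp add: sum_product)
  finally show "?S (m * n) = ?S m * ?S n" .
qed simp

text \<open>Prescribing values at prime powers gives multiplicativity at once, so Jordan's totient
  and the Moebius transform can be introduced without a Dirichlet convolution.\<close>

definition prime_power_prod :: "(nat \<Rightarrow> nat \<Rightarrow> real) \<Rightarrow> nat \<Rightarrow> real" where
  "prime_power_prod G n = (\<Prod>p\<in>prime_factors n. G p (multiplicity p n))"

lemma prime_power_prod_prime_power:
  assumes "prime p" "k > 0"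
  shows "prime_power_prod G (p ^ k) = G p k"
  using assms by (simp add: prime_power_prod_def prime_factors_power prime_prime_factors)

lemma multiplicative_fun_prime_power_prod: "multiplicative_fun (prime_power_prod G)"
  unfolding multiplicative_fun_def
proof (intro conjI allI impI)
  show "prime_power_prod G 1 = 1" by (simp add: prime_power_prod_def)
next
  fix m n :: nat assume *: "m > 0" "n > 0" "coprime m n"
  have disj: "prime_factors m \<inter> prime_factors n = {}"
    using * by (auto simp: prime_factors_dvd) (meson coprime_common_divisor not_prime_unit)
  have pf: "prime_factors (m * n) = prime_factors m \<union> prime_factors n"
    using * by (simp add: prime_factors_product)
  have m: "multiplicity p (m * n) = multiplicity p m" if "p \<in> prime_factors m" for p
    using that * disj by (simp add: prime_elem_multiplicity_mult_distrib in_prime_factors_iff)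
      (metis IntI empty_iff in_prime_factors_iff not_dvd_imp_multiplicity_0 neq0_conv)
  have n: "multiplicity p (m * n) = multiplicity p n" if "p \<in> prime_factors n" for p
    using that * disj by (simp add: prime_elem_multiplicity_mult_distrib in_prime_factors_iff)
      (metis IntI empty_iff in_prime_factors_iff not_dvd_imp_multiplicity_0 neq0_conv)
  show "prime_power_prod G (m * n) = prime_power_prod G m * prime_power_prod G n"
    unfolding prime_power_prod_def pf using m n
    by (simp add: prod.union_disjoint[OF _ _ disj])
qed

section \<open>Counting cyclic subgroups\<close>

lemma (in group) cyclic_subgroups_eq_image:
  "cyclic_subgroups_of G = (\<lambda>x. generate G {x}) ` carrier G"
proof (intro equalityI subsetI)
  fix H assume "H \<in> cyclic_subgroups_of G"
  then have H: "subgroup H G" and c: "cyclic_group (G\<lparr>carrier := H\<rparr>)"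
    by (auto simp: cyclic_subgroups_of_def)
  interpret H: group "G\<lparr>carrier := H\<rparr>" using H by (rule subgroup_imp_group)
  obtain x where x: "x \<in> H" "H = range (\<lambda>n::int. x [^]\<^bsub>G\<lparr>carrier := H\<rparr>\<^esub> n)"
    using c unfolding H.cyclic_group by auto
  then have "H = range (\<lambda>n::int. x [^] n)"
    using int_pow_consistent[OF H x(1)] by simp
  moreover have "x \<in> carrier G" using x H by (meson subgroup.mem_carrier)
  ultimately show "H \<in> (\<lambda>x. generate G {x}) ` carrier G"
    by (auto simp: generate_pow full_SetCompr_eq)
next
  fix H assume "H \<in> (\<lambda>x. generate G {x}) ` carrier G"
  then obtain x where x: "x \<in> carrier G" "H = generate G {x}" by auto
  have "subgroup H G" using x generate_is_subgroup[of "{x}"] by simp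
  moreover have "cyclic_group (G\<lparr>carrier := H\<rparr>)"
    using cyclic_group_generated[of x] x by (simp add: subgroup_generated_def)
  ultimately show "H \<in> cyclic_subgroups_of G"
    by (simp add: cyclic_subgroups_of_def)
qed

text \<open>An element of the group generated by \<open>y\<close> generates all of it exactly when
  its order is \<open>ord y\<close>, and \<open>y [^] k\<close> has that order exactly when
  \<open>k\<close> is coprime to \<open>ord y\<close>.\<close>

lemma (in group) generators_of_cyclic:
  assumes fin: "finite (carrier G)" and y: "y \<in> carrier G"
  shows "{x \<in> carrier G. generate G {x} = generate G {y}} = (\<lambda>k. y [^] k) ` totatives (ord y)"
proof (intro equalityI subsetI)
  fix x assume "x \<in> {x \<in> carrier G. generate G {x} = generate G {y}}"
  then have x: "x \<in> carrier G" and eq: "generate G {x} = generate G {y}" by auto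
  have o: "ord x = ord y" using generate_pow_card x y eq by simp
  have "x \<in> generate G {y}" using eq generate.incl[of x "{x}" G] by simp
  then obtain j :: nat where j: "x = y [^] j"
    unfolding generate_pow_on_finite_carrier[OF fin y] by auto
  \<comment> \<open>\<open>totatives\<close> takes representatives from 1 to \<open>ord y\<close>,
    so a multiple of the order is represented by \<open>ord y\<close> and not by 0; this covers the
    identity element.\<close>
  define k where "k = (if ord y dvd j then ord y else j mod ord y)"
  have pos: "ord y > 0" using ord_ge_1[OF fin y] by simp
  have "y [^] j = y [^] (j mod ord y)"
  proof -
    have "y [^] (ord y * (j div ord y)) = \<one>" using y by (simp add: pow_eq_id)
    then have "y [^] (ord y * (j div ord y) + j mod ord y) = y [^] (j mod ord y)"
      using y nat_pow_mult[of y "ord y * (j div ord y)" "j mod ord y"] by simp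
    then show ?thesis by (simp only: mult_div_mod_eq)
  qed
  then have xk: "x = y [^] k"
    using j y by (auto simp: k_def pow_eq_id)
  then have "coprime k (ord y)"
    using pow_ord_eq_ord_iff[OF fin y, of k] o by simp
  moreover have "k > 0" "k \<le> ord y"
    using pos by (auto simp: k_def dvd_eq_mod_eq_0 less_imp_le)
  ultimately show "x \<in> (\<lambda>k. y [^] k) ` totatives (ord y)"
    using xk by (auto simp: in_totatives_iff)
next
  fix x assume "x \<in> (\<lambda>k. y [^] k) ` totatives (ord y)"
  then obtain k where k: "x = y [^] k" "coprime k (ord y)"
    by (auto simp: in_totatives_iff)
  have x: "x \<in> carrier G" using k y by simp
  have "ord x = ord y" using k pow_ord_eq_ord_iff[OF fin y] by simp
  then have "card (generate G {x}) = card (generate G {y})"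
    using generate_pow_card x y by simp
  moreover have "x \<in> generate G {y}"
    unfolding generate_pow_on_finite_carrier[OF fin y] using k by auto
  then have "generate G {x} \<subseteq> generate G {y}"
    using y by (intro generate_subgroup_incl generate_is_subgroup) auto
  moreover have "finite (generate G {y})"
    using generate_incl[of "{y}"] y fin finite_subset by blast
  ultimately have "generate G {x} = generate G {y}"
    by (simp add: card_subset_eq)
  then show "x \<in> {x \<in> carrier G. generate G {x} = generate G {y}}" using x by simp
qed

text \<open>The generators of a cyclic subgroup share one order \<open>r\<close> and number
  \<open>totient r\<close>, so with these weights they contribute 1 in total.\<close>

lemma (in group) card_cyclic_subgroups:
  assumes fin: "finite (carrier G)"
  shows "real (card (cyclic_subgroups_of G)) = (\<Sum>x\<in>carrier G. 1 / real (totient (ord x)))"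
proof -
  have "(\<Sum>x | x \<in> carrier G \<and> generate G {x} = H. 1 / real (totient (ord x))) = 1"
    if H: "H \<in> (\<lambda>x. generate G {x}) ` carrier G" for H
  proof -
    obtain y where y: "y \<in> carrier G" "H = generate G {y}" using H by auto
    have "ord x = ord y" if "x \<in> carrier G" "generate G {x} = H" for x
      using generate_pow_card that y by simp
    then have "(\<Sum>x | x \<in> carrier G \<and> generate G {x} = H. 1 / real (totient (ord x)))
        = (\<Sum>x | x \<in> carrier G \<and> generate G {x} = H. 1 / real (totient (ord y)))"
      by (intro sum.cong) auto
    also have "\<dots> = real (card ((\<lambda>k. y [^] k) ` totatives (ord y))) / real (totient (ord y))"
      using generators_of_cyclic[OF fin y(1)] y(2) by simp
    also have "card ((\<lambda>k. y [^] k) ` totatives (ord y)) = totient (ord y)"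
      unfolding totient_def
      by (intro card_image inj_on_subset[OF ord_inj'[OF y(1)]])
        (auto simp: in_totatives_iff)
    finally show ?thesis using ord_ge_1[OF fin y(1)] by simp
  qed
  then have "(\<Sum>x\<in>carrier G. 1 / real (totient (ord x))) = (\<Sum>H\<in>(\<lambda>x. generate G {x}) ` carrier G. 1)"
    by (subst sum.image_gen[OF fin, where g = "\<lambda>x. generate G {x}"]) (rule sum.cong, auto)
  then show ?thesis by (simp add: cyclic_subgroups_eq_image)
qed

section \<open>Element orders in the square of a cyclic group\<close>

abbreviation Z_square :: "nat \<Rightarrow> (int \<times> int) monoid" where
  "Z_square n \<equiv> integer_mod_group n \<times>\<times> integer_mod_group n"

lemma group_Z_square: "group (Z_square n)"
  by (intro DirProd_group) simp_all

lemma finite_Z_square: "n > 0 \<Longrightarrow> finite (carrier (Z_square n))"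
  by (simp add: carrier_integer_mod_group)

lemma pow_Z_square: "(x, y) [^]\<^bsub>Z_square n\<^esub> (k::nat) = (int k * x mod int n, int k * y mod int n)"
proof (induction k)
  case (Suc k)
  then show ?case by (simp add: nat_pow_def mod_simps algebra_simps)
qed (simp add: nat_pow_def DirProd_def)

text \<open>With \<open>g = gcd n c\<close> the condition says that \<open>n div g\<close> divides
  \<open>x\<close>, since \<open>c div g\<close> is coprime to \<open>n div g\<close>; the interval
  holds \<open>g\<close> such multiples. Both the torsion count and the count of Hermite normal
  forms rest on this.\<close>

lemma card_mod_solutions:
  assumes "n > 0"
  shows "card {x \<in> {0..<int n}. int n dvd int c * x} = gcd n c"
proof -
  define g where "g = gcd n c"
  have g: "g > 0" "g dvd n" "g dvd c" using assms by (auto simp: g_def)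
  define m where "m = n div g"
  have n: "n = m * g" using g by (simp add: m_def)
  have m: "m > 0" using n assms by (cases m) auto
  have "coprime m (c div g)" unfolding m_def g_def using assms 
    by (intro div_gcd_coprime) auto
  then have cop: "coprime (int m) (int (c div g))" by simp
  have iff: "int n dvd int c * x \<longleftrightarrow> int m dvd x" for x
  proof -
    have "int c * x = int g * (int (c div g) * x)"
      using g(3) by (metis dvd_mult_div_cancel mult.assoc of_nat_mult)
    moreover have "int n = int g * int m" using n by simp
    ultimately have "int n dvd int c * x \<longleftrightarrow> int m dvd int (c div g) * x"
      using g(1) by (metis dvd_mult_cancel_left of_nat_0_less_iff less_irrefl)
    then show ?thesis using cop by (simp add: coprime_dvd_mult_right_iff)
  qed
  have "{x \<in> {0..<int n}. int n dvd int c * x} = (\<lambda>i. int m * int i) ` {..<g}"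
  proof (intro equalityI subsetI)
    fix x assume "x \<in> {x \<in> {0..<int n}. int n dvd int c * x}"
    then obtain i where i: "x = int m * i" "0 \<le> x" "x < int n" using iff by auto
    then have "i \<ge> 0" using m by (simp add: zero_le_mult_iff)
    moreover have "i < int g" using i n m by simp
    ultimately show "x \<in> (\<lambda>i. int m * int i) ` {..<g}"
      using i by (intro image_eqI[of _ _ "nat i"]) auto
  next
    fix x assume "x \<in> (\<lambda>i. int m * int i) ` {..<g}"
    then obtain i where i: "x = int (m * i)" "i < g" by auto
    then have "int m * int i < int n" using n m by (simp flip: of_nat_mult)
    then show "x \<in> {x \<in> {0..<int n}. int n dvd int c * x}"
      using i(1) iff by simp
  qed
  moreover have "inj_on (\<lambda>i. int m * int i) {..<g}" using m by (auto intro: inj_onI)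
  ultimately show ?thesis by (simp add: card_image g_def)
qed

lemma card_order_dvd_Z_square:
  assumes "n > 0" "d dvd n"
  shows "card {z \<in> carrier (Z_square n). group.ord (Z_square n) z dvd d} = d ^ 2"
proof -
  interpret group "Z_square n" by (rule group_Z_square)
  have "{z \<in> carrier (Z_square n). ord z dvd d} =
      {x \<in> {0..<int n}. int n dvd int d * x} \<times> {x \<in> {0..<int n}. int n dvd int d * x}"
  proof (rule Set.set_eqI)
    fix z :: "int \<times> int"
    obtain x y where z: "z = (x, y)" by (cases z)
    show "z \<in> {z \<in> carrier (Z_square n). ord z dvd d} \<longleftrightarrow> z \<in> {x \<in> {0..<int n}. int n dvd int d * x} \<times> {x \<in> {0..<int n}. int n dvd int d * x}"
      using assms pow_eq_id[of "(x,y)" d] unfolding z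
      by (simp add: pow_Z_square carrier_integer_mod_group dvd_eq_mod_eq_0) auto
  qed
  then show ?thesis using assms card_mod_solutions[of n d]
    by (simp add: card_cartesian_product power2_eq_square gcd_nat.absorb2)
qed

text \<open>Jordan's totient of order 2: for positive \<open>n\<close>, the product of
  \<open>n ^ 2\<close> and all \<open>1 - 1 / p ^ 2\<close> with \<open>p\<close> a prime divisor of
  \<open>n\<close>.\<close>

definition jordan2 :: "nat \<Rightarrow> real" where
  "jordan2 = prime_power_prod (\<lambda>p k. real p ^ (2 * k) - real p ^ (2 * k - 2))"

lemma multiplicative_fun_jordan2: "multiplicative_fun jordan2"
  by (simp add: jordan2_def multiplicative_fun_prime_power_prod)

lemma jordan2_prime_power_Suc:
  "prime p \<Longrightarrow> jordan2 (p ^ Suc k) = real p ^ (2 * k + 2) - real p ^ (2 * k)"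
  unfolding jordan2_def by (subst prime_power_prod_prime_power) simp_all

text \<open>By multiplicativity only prime powers matter, and there the differences defining
  \<open>jordan2\<close> telescope.\<close>

lemma jordan2_divisor_sum:
  assumes "n > 0"
  shows "(\<Sum>d | d dvd n. jordan2 d) = real n ^ 2"
proof (rule multiplicative_fun_eqI[OF _ _ assms])
  show "multiplicative_fun (\<lambda>n. real n ^ 2)"
    by (simp add: multiplicative_fun_def power_mult_distrib)
next
  fix p k :: nat assume p: "prime p"
  have "(\<Sum>i\<le>k. jordan2 (p ^ i)) = real p ^ (2 * k)"
    by (induction k) (use p in \<open>auto simp: jordan2_prime_power_Suc multiplicative_fun_1[OF multiplicative_fun_jordan2] simp del: power_Suc\<close>)
  then show "(\<Sum>d | d dvd p ^ k. jordan2 d) = real (p ^ k) ^ 2"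
    using p by (simp add: sum_divisors_prime_power power_mult mult.commute)
qed (intro multiplicative_fun_divisor_sum multiplicative_fun_jordan2)

text \<open>Both sides have divisor sum \<open>d ^ 2\<close>. Strong induction equates the terms at
  proper divisors, hence also the remaining term at \<open>d\<close>; this replaces an explicit
  Moebius inversion.\<close>

lemma card_order_eq_Z_square:
  assumes "n > 0" "d dvd n"
  shows "real (card {z \<in> carrier (Z_square n). group.ord (Z_square n) z = d}) = jordan2 d"
  using \<open>d dvd n\<close>
proof (induction d rule: less_induct)
  case (less d)
  interpret group "Z_square n" by (rule group_Z_square)
  let ?N = "\<lambda>d. {z \<in> carrier (Z_square n). ord z = d}"
  have d: "d > 0" using assms less.prems dvd_pos_nat by blast
  have fin: "finite (carrier (Z_square n))" using assms by (intro finite_Z_square)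
  have "{z \<in> carrier (Z_square n). ord z dvd d} = (\<Union>e\<in>{e. e dvd d}. ?N e)" by auto
  then have "d ^ 2 = card (\<Union>e\<in>{e. e dvd d}. ?N e)"
    using card_order_dvd_Z_square[OF assms(1) less.prems] by simp
  also have "\<dots> = (\<Sum>e | e dvd d. card (?N e))"
    by (rule card_UN_disjoint) (use d fin in auto)
  finally have "real (d ^ 2) = real (\<Sum>e | e dvd d. card (?N e))"
    by (rule arg_cong)
  then have "real d ^ 2 = (\<Sum>e | e dvd d. real (card (?N e)))"
    by simp
  moreover have split: "{e. e dvd d} = insert d {e. e dvd d \<and> e < d}"
  proof (rule Set.set_eqI)
    fix e show "e \<in> {e. e dvd d} \<longleftrightarrow> e \<in> insert d {e. e dvd d \<and> e < d}"
      using dvd_imp_le[of e d] d by (cases "e = d") auto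
  qed
  moreover have fin': "finite {e. e dvd d \<and> e < d}"
    by (rule finite_subset[of _ "{..<d}"]) auto
  ultimately have 1: "real d ^ 2 = real (card (?N d)) + (\<Sum>e | e dvd d \<and> e < d. real (card (?N e)))"
    by (simp only: split sum.insert[OF fin'] mem_Collect_eq less_irrefl simp_thms)
  have 2: "real d ^ 2 = jordan2 d + (\<Sum>e | e dvd d \<and> e < d. jordan2 e)"
    using jordan2_divisor_sum[OF d] unfolding split
    by (simp only: sum.insert[OF fin'] mem_Collect_eq less_irrefl simp_thms)
  have "(\<Sum>e | e dvd d \<and> e < d. real (card (?N e))) = (\<Sum>e | e dvd d \<and> e < d. jordan2 e)"
    using less by (intro sum.cong) auto
  then show ?case using 1 2 by linarith
qed

lemma card_cyclic_subgroups_Z_square: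
  assumes "n > 0"
  shows "real (card (cyclic_subgroups_of (Z_square n))) = (\<Sum>d | d dvd n. jordan2 d / real (totient d))"
proof -
  interpret group "Z_square n" by (rule group_Z_square)
  have fin: "finite (carrier (Z_square n))" using assms by (intro finite_Z_square)
  have ord_dvd: "ord z dvd n" if "z \<in> carrier (Z_square n)" for z
    using that pow_eq_id[OF that, of n] by (cases z) (simp add: pow_Z_square)
  have "(\<Sum>z\<in>carrier (Z_square n). 1 / real (totient (ord z))) =
      (\<Sum>d | d dvd n. \<Sum>z | z \<in> carrier (Z_square n) \<and> ord z = d. 1 / real (totient (ord z)))"
    by (rule sum.group[symmetric]) (use fin assms ord_dvd in auto)
  also have "\<dots> = (\<Sum>d | d dvd n. jordan2 d / real (totient d))"
  proof (intro sum.cong refl)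
    fix d assume "d \<in> {d. d dvd n}"
    then have "real (card {z \<in> carrier (Z_square n). ord z = d}) = jordan2 d"
      using card_order_eq_Z_square assms by simp
    then show "(\<Sum>z | z \<in> carrier (Z_square n) \<and> ord z = d. 1 / real (totient (ord z))) = jordan2 d / real (totient d)"
      by simp
  qed
  finally show ?thesis using card_cyclic_subgroups[OF fin] by simp
qed

section \<open>Counting subgroups\<close>

text \<open>These are the preimages in the integer plane of subgroups of \<open>Z_square n\<close>.
  Predicates on all integers avoid carrying residues through the lattice arguments, and closure
  under differences yields zero, negatives and sums.\<close>

definition periodic_lattice :: "nat \<Rightarrow> (int \<Rightarrow> int \<Rightarrow> bool) \<Rightarrow> bool" where
  "periodic_lattice n Q \<longleftrightarrow> Q 0 (int n) \<and> Q (int n) 0 \<and>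
     (\<forall>x y x' y'. Q x y \<longrightarrow> Q x' y' \<longrightarrow> Q (x - x') (y - y'))"

lemma periodic_lattice_diff:
  "periodic_lattice n Q \<Longrightarrow> Q x y \<Longrightarrow> Q x' y' \<Longrightarrow> Q (x - x') (y - y')"
  by (simp add: periodic_lattice_def)

lemma periodic_lattice_zero: "periodic_lattice n Q \<Longrightarrow> Q 0 0"
  using periodic_lattice_diff[of n Q 0 "int n" 0 "int n"] by (simp add: periodic_lattice_def)

lemma periodic_lattice_add:
  assumes "periodic_lattice n Q" "Q x y" "Q x' y'"
  shows "Q (x + x') (y + y')"
  using periodic_lattice_diff[OF assms(1,2) periodic_lattice_diff[OF assms(1) periodic_lattice_zero[OF assms(1)] assms(3)]]
  by simp

lemma periodic_lattice_scale:
  assumes "periodic_lattice n Q" "Q x y"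
  shows "Q (k * x) (k * y)"
proof (induction k rule: int_induct[of _ 0])
  case base
  then show ?case using periodic_lattice_zero[OF assms(1)] by simp
next
  case (step1 i)
  then show ?case using periodic_lattice_add[OF assms(1) _ assms(2), of "i * x" "i * y"]
    by (simp add: algebra_simps)
next
  case (step2 i)
  then show ?case using periodic_lattice_diff[OF assms(1) _ assms(2), of "i * x" "i * y"]
    by (simp add: algebra_simps)
qed

text \<open>Reduction subtracts a vector with both coordinates divisible by \<open>n\<close>, which
  lies in the lattice. Hence a lattice is determined by its points in the residue range.\<close>

lemma periodic_lattice_mod:
  assumes "periodic_lattice n Q"
  shows "Q (x mod int n) (y mod int n) \<longleftrightarrow> Q x y"
proof -
  define u v where "u = (x div int n) * int n" and "v = (y div int n) * int n"
  have "Q (int n) 0" "Q 0 (int n)" using assms by (simp_all add: periodic_lattice_def)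
  then have "Q u 0" "Q 0 v"
    using periodic_lattice_scale[OF assms, of "int n" 0 "x div int n"]
      periodic_lattice_scale[OF assms, of 0 "int n" "y div int n"] by (simp_all add: u_def v_def)
  then have uv: "Q u v" using periodic_lattice_add[OF assms, of u 0 0 v] by simp
  have m: "x mod int n = x - u" "y mod int n = y - v"
    by (simp_all add: u_def v_def minus_div_mult_eq_mod)
  show ?thesis
    using periodic_lattice_diff[OF assms _ uv, of x y] periodic_lattice_add[OF assms _ uv, of "x - u" "y - v"]
    unfolding m by auto
qed

lemma periodic_lattice_of_subgroup:
  assumes "n > 0" "subgroup H (Z_square n)"
  shows "periodic_lattice n (\<lambda>x y. (x mod int n, y mod int n) \<in> H)"
proof -
  interpret group "Z_square n" by (rule group_Z_square)
  have "(0, 0) \<in> H" using subgroup.one_closed[OF assms(2)] by simp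
  moreover have "((x - x') mod int n, (y - y') mod int n) \<in> H"
    if "(x mod int n, y mod int n) \<in> H" "(x' mod int n, y' mod int n) \<in> H" for x y x' y'
  proof -
    have "inv\<^bsub>Z_square n\<^esub> (x' mod int n, y' mod int n) = (- x' mod int n, - y' mod int n)"
      using assms(1) by (subst inv_DirProd) (simp_all add: carrier_integer_mod_group mod_simps)
    then have "(- x' mod int n, - y' mod int n) \<in> H"
      using subgroup.m_inv_closed[OF assms(2) that(2)] by simp
    from subgroup.m_closed[OF assms(2) that(1) this] show ?thesis by (simp add: mod_simps)
  qed
  ultimately show ?thesis by (simp add: periodic_lattice_def)
qed

lemma subgroup_of_periodic_lattice:
  assumes "n > 0" "periodic_lattice n Q"
  shows "subgroup {(x, y) \<in> carrier (Z_square n). Q x y} (Z_square n)"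
proof -
  interpret group "Z_square n" by (rule group_Z_square)
  show ?thesis
  proof (rule subgroupI)
    show "{(x, y) \<in> carrier (Z_square n). Q x y} \<noteq> {}"
      using periodic_lattice_zero[OF assms(2)] assms(1)
      by (auto simp: carrier_integer_mod_group intro!: exI[of _ 0])
  next
    fix z assume "z \<in> {(x, y) \<in> carrier (Z_square n). Q x y}"
    then obtain x y where z: "z = (x, y)" "(x, y) \<in> carrier (Z_square n)" "Q x y" by auto
    have "inv\<^bsub>Z_square n\<^esub> (x, y) = (- x mod int n, - y mod int n)"
      using z(2) by (subst inv_DirProd) simp_all
    moreover have "Q (- x) (- y)"
      using periodic_lattice_diff[OF assms(2) periodic_lattice_zero[OF assms(2)] z(3)] by simp
    ultimately show "inv\<^bsub>Z_square n\<^esub> z \<in> {(x, y) \<in> carrier (Z_square n). Q x y}"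
      using assms z(1) by (simp add: periodic_lattice_mod carrier_integer_mod_group)
  next
    fix z z' assume "z \<in> {(x, y) \<in> carrier (Z_square n). Q x y}" "z' \<in> {(x, y) \<in> carrier (Z_square n). Q x y}"
    then obtain x y x' y' where "z = (x, y)" "Q x y" "z' = (x', y')" "Q x' y'" by auto
    then show "z \<otimes>\<^bsub>Z_square n\<^esub> z' \<in> {(x, y) \<in> carrier (Z_square n). Q x y}"
      using assms periodic_lattice_add[OF assms(2)]
      by (simp add: periodic_lattice_mod carrier_integer_mod_group)
  qed auto
qed

text \<open>The generator is the least positive element; division with remainder shows that it
  divides every other element, in particular \<open>n\<close>.\<close>

lemma int_subgroup_eq_multiples:
  fixes A :: "int \<Rightarrow> bool"
  assumes "n > 0" "A (int n)" and diff: "\<And>x y. A x \<Longrightarrow> A y \<Longrightarrow> A (x - y)"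
  obtains a where "a dvd n" "a > 0" "\<And>x. A x \<longleftrightarrow> int a dvd x"
proof -
  define a where "a = (LEAST a. a > 0 \<and> A (int a))"
  have a: "a > 0 \<and> A (int a)" unfolding a_def by (rule LeastI[of _ n]) (use assms in auto)
  have min: "\<not> A (int m)" if "0 < m" "m < a" for m
    using not_less_Least[of m "\<lambda>a. a > 0 \<and> A (int a)"] that by (auto simp: a_def)
  have zero: "A 0" using diff[of "int n" "int n"] assms by simp
  have add: "A (x + y)" if "A x" "A y" for x y
    using diff[OF that(1) diff[OF zero that(2)]] by simp
  have mult: "A (k * int a)" for k
  proof (induction k rule: int_induct[of _ 0])
    case (step1 i)
    then show ?case using add[of "i * int a" "int a"] a by (simp add: algebra_simps)
  next
    case (step2 i)
    then show ?case using diff[of "i * int a" "int a"] a by (simp add: algebra_simps)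
  qed (use zero in simp)
  have iff: "A x \<longleftrightarrow> int a dvd x" for x
  proof
    assume "A x"
    then have "A (x - (x div int a) * int a)" using mult diff by blast
    then have "A (int (nat (x mod int a)))" using a by (simp add: minus_div_mult_eq_mod)
    moreover have "nat (x mod int a) < a" using a by (simp add: nat_less_iff)
    ultimately have "nat (x mod int a) = 0" using min by blast
    moreover have "x mod int a \<ge> 0" using a by simp
    ultimately show "int a dvd x" by (intro mod_0_imp_dvd) linarith
  next
    assume "int a dvd x"
    then show "A x" using mult by (metis dvd_def mult.commute)
  qed
  moreover have "a dvd n" using iff assms(2) by simp
  ultimately show ?thesis using that a by blast
qed

text \<open>Hermite normal form: the lattice spanned by \<open>(a, s)\<close> and \<open>(0, b)\<close>. The last condition in
  the parameter set says that \<open>(n, 0)\<close> lies in the lattice.\<close>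

definition hnf_lattice :: "nat \<Rightarrow> nat \<Rightarrow> int \<Rightarrow> int \<Rightarrow> int \<Rightarrow> bool" where
  "hnf_lattice a b s x y \<longleftrightarrow> int a dvd x \<and> int b dvd y - (x div int a) * s"

definition hnf_params :: "nat \<Rightarrow> (nat \<times> nat \<times> int) set" where
  "hnf_params n = (SIGMA a:{a. a dvd n}. SIGMA b:{b. b dvd n}. {s \<in> {0..<int b}. int b dvd int (n div a) * s})"

lemma periodic_hnf_lattice:
  assumes "n > 0" "(a, b, s) \<in> hnf_params n"
  shows "periodic_lattice n (hnf_lattice a b s)"
proof -
  have ab: "a dvd n" "b dvd n" "int b dvd int (n div a) * s"
    using assms by (auto simp: hnf_params_def)
  have "hnf_lattice a b s (x - x') (y - y')" if "hnf_lattice a b s x y" "hnf_lattice a b s x' y'" for x y x' y'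
  proof -
    \<comment> \<open>Division by \<open>a\<close> is additive here because both first coordinates
      are multiples of \<open>a\<close>.\<close>
    have "(x - x') div int a = x div int a - x' div int a"
      using that by (auto simp: hnf_lattice_def intro: div_diff)
    then have "(y - y') - ((x - x') div int a) * s = (y - (x div int a) * s) - (y' - (x' div int a) * s)"
      by (simp only: left_diff_distrib)
    then show ?thesis using that unfolding hnf_lattice_def by (metis dvd_diff)
  qed
  moreover have "hnf_lattice a b s 0 (int n)" using ab by (simp add: hnf_lattice_def)
  moreover have "hnf_lattice a b s (int n) 0" using ab by (simp add: hnf_lattice_def of_nat_div)
  ultimately show ?thesis by (simp add: periodic_lattice_def)
qed

text \<open>Each lattice contains the points \<open>(a, s)\<close> and \<open>(0, b)\<close> of the
  other. Comparing coordinates gives mutual divisibility of the \<open>a\<close> and of the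
  \<open>b\<close>; then \<open>s\<close> and \<open>s'\<close> agree modulo \<open>b\<close> and
  lie in the same residue range.\<close>

lemma hnf_lattice_eqD:
  assumes "n > 0" "(a, b, s) \<in> hnf_params n" "(a', b', s') \<in> hnf_params n"
    and eq: "hnf_lattice a b s = hnf_lattice a' b' s'"
  shows "a = a' \<and> b = b' \<and> s = s'"
proof -
  have p: "a dvd n" "a' dvd n" "0 \<le> s" "s < int b" "0 \<le> s'" "s' < int b'"
    using assms by (auto simp: hnf_params_def)
  have pos: "a > 0" "a' > 0" using p assms(1) dvd_pos_nat by blast+
  have "hnf_lattice a b s (int a) s" using pos by (simp add: hnf_lattice_def)
  then have 1: "hnf_lattice a' b' s' (int a) s" using eq by simp
  have "hnf_lattice a' b' s' (int a') s'" using pos by (simp add: hnf_lattice_def)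
  then have 2: "hnf_lattice a b s (int a') s'" using eq by simp
  have a: "a = a'" using 1 2 by (auto simp: hnf_lattice_def dvd_antisym)
  have "hnf_lattice a b s 0 (int b)" "hnf_lattice a' b' s' 0 (int b')" by (simp_all add: hnf_lattice_def)
  then have "hnf_lattice a' b' s' 0 (int b)" "hnf_lattice a b s 0 (int b')" using eq by simp_all
  then have b: "b = b'" by (auto simp: hnf_lattice_def dvd_antisym)
  have "int b dvd s - s'" using 1 a b pos by (simp add: hnf_lattice_def)
  then have "s mod int b = s' mod int b" by (simp add: mod_eq_dvd_iff)
  then have "s = s'" using p b by simp
  then show ?thesis using a b by simp
qed

text \<open>\<open>a\<close> generates the projection to the first coordinate, \<open>b\<close> the
  fibre over 0, and \<open>s\<close> is the second coordinate, reduced modulo \<open>b\<close>, of a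
  lattice point over \<open>a\<close>. Any other lattice point differs from a multiple of
  \<open>(a, s)\<close> by a point of the fibre over 0.\<close>

lemma periodic_lattice_hnf_exists:
  assumes "n > 0" and Q: "periodic_lattice n Q"
  obtains a b s where "(a, b, s) \<in> hnf_params n" "Q = hnf_lattice a b s"
proof -
  have Qn: "Q 0 (int n)" "Q (int n) 0" using Q by (simp_all add: periodic_lattice_def)
  have "\<exists>y. Q (x - x') y" if "\<exists>y. Q x y" "\<exists>y. Q x' y" for x x'
    using that periodic_lattice_diff[OF Q] by blast
  then obtain a where a: "a dvd n" "a > 0" "\<And>x. (\<exists>y. Q x y) \<longleftrightarrow> int a dvd x"
    using int_subgroup_eq_multiples[OF assms(1), of "\<lambda>x. \<exists>y. Q x y"] Qn by metis
  have "Q 0 (y - y')" if "Q 0 y" "Q 0 y'" for y y'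
    using periodic_lattice_diff[OF Q that] by simp
  then obtain b where b: "b dvd n" "b > 0" "\<And>y. Q 0 y \<longleftrightarrow> int b dvd y"
    using int_subgroup_eq_multiples[OF assms(1), of "Q 0"] Qn by metis
  obtain s0 where s0: "Q (int a) s0" using a(3)[of "int a"] by auto
  define s where "s = s0 mod int b"
  have "Q 0 (s0 - s)" using b(3) by (simp add: s_def)
  then have s: "Q (int a) s" using periodic_lattice_diff[OF Q s0, of 0 "s0 - s"] by simp
  have ks: "Q (k * int a) (k * s)" for k by (rule periodic_lattice_scale[OF Q s])
  have iff: "Q x y \<longleftrightarrow> hnf_lattice a b s x y" for x y
  proof (cases "int a dvd x")
    case True
    then have x: "Q x (x div int a * s)" using ks[of "x div int a"] by simp
    have "Q x y \<longleftrightarrow> Q 0 (y - x div int a * s)"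
      using periodic_lattice_diff[OF Q _ x, of x y] periodic_lattice_add[OF Q _ x, of 0 "y - x div int a * s"] by auto
    then show ?thesis using True b(3) by (simp add: hnf_lattice_def)
  next
    case False
    then show ?thesis using a(3)[of x] by (auto simp: hnf_lattice_def)
  qed
  \<comment> \<open>The multiple of \<open>(a, s)\<close> over \<open>n\<close> differs from the
    lattice point \<open>(n, 0)\<close> by a point over 0.\<close>
  have "int b dvd int (n div a) * s"
  proof -
    have "int (n div a) * int a = int n" using a(1) by (simp flip: of_nat_mult)
    then have "Q (int n) (int (n div a) * s)" using ks[of "int (n div a)"] by simp
    then have "Q 0 (int (n div a) * s)"
      using periodic_lattice_diff[OF Q _ Qn(2), of "int n" "int (n div a) * s"] by simp
    then show ?thesis using b(3) by simp
  qed
  moreover have "0 \<le> s" "s < int b" using b(2) by (simp_all add: s_def)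
  ultimately have "(a, b, s) \<in> hnf_params n" using a b by (simp add: hnf_params_def)
  moreover have "Q = hnf_lattice a b s" using iff by (intro ext) simp
  ultimately show ?thesis by (rule that)
qed

lemma bij_betw_hnf_params_subgroups:
  assumes "n > 0"
  shows "bij_betw (\<lambda>(a, b, s). {(x, y) \<in> carrier (Z_square n). hnf_lattice a b s x y})
    (hnf_params n) (subgroups_of (Z_square n))"
proof -
  define F where "F = (\<lambda>(a, b, s). {(x, y) \<in> carrier (Z_square n). hnf_lattice a b s x y})"
  have mem: "(x mod int n, y mod int n) \<in> F (a, b, s) \<longleftrightarrow> hnf_lattice a b s x y"
    if "(a, b, s) \<in> hnf_params n" for a b s x y
    using periodic_lattice_mod[OF periodic_hnf_lattice[OF assms that]] assms
    by (simp add: F_def carrier_integer_mod_group)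
  have "inj_on F (hnf_params n)"
  proof (rule inj_onI)
    fix t t' assume t: "t \<in> hnf_params n" "t' \<in> hnf_params n" and eq: "F t = F t'"
    obtain a b s where abs: "t = (a, b, s)" by (cases t)
    obtain a' b' s' where abs': "t' = (a', b', s')" by (cases t')
    have "hnf_lattice a b s x y = hnf_lattice a' b' s' x y" for x y
      using mem[of a b s x y] mem[of a' b' s' x y] t eq unfolding abs abs' by simp
    then have "hnf_lattice a b s = hnf_lattice a' b' s'" by (intro ext)
    then show "t = t'" using hnf_lattice_eqD[OF assms] t unfolding abs abs' by simp
  qed
  moreover have "F ` hnf_params n = subgroups_of (Z_square n)"
  proof (intro equalityI subsetI)
    fix H assume "H \<in> F ` hnf_params n"
    then obtain a b s where "(a, b, s) \<in> hnf_params n" "H = F (a, b, s)" by auto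
    then show "H \<in> subgroups_of (Z_square n)"
      using subgroup_of_periodic_lattice[OF assms periodic_hnf_lattice[OF assms, of a b s]]
      by (simp add: subgroups_of_def F_def)
  next
    fix H assume "H \<in> subgroups_of (Z_square n)"
    then have H: "subgroup H (Z_square n)" by (simp add: subgroups_of_def)
    obtain a b s where abs: "(a, b, s) \<in> hnf_params n"
      and eq: "(\<lambda>x y. (x mod int n, y mod int n) \<in> H) = hnf_lattice a b s"
      using periodic_lattice_hnf_exists[OF assms periodic_lattice_of_subgroup[OF assms H]] .
    have "(x, y) \<in> H \<longleftrightarrow> (x, y) \<in> F (a, b, s)" if "(x, y) \<in> carrier (Z_square n)" for x y
      using that fun_cong[OF fun_cong[OF eq], of x y] assms by (simp add: F_def carrier_integer_mod_group)
    moreover have "H \<subseteq> carrier (Z_square n)" using H by (rule subgroup.subset)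
    moreover have "F (a, b, s) \<subseteq> carrier (Z_square n)" by (auto simp: F_def)
    ultimately have "H = F (a, b, s)" by (metis Set.set_eqI subsetD prod.exhaust)
    then show "H \<in> F ` hnf_params n" using abs by blast
  qed
  ultimately show ?thesis by (simp add: bij_betw_def F_def)
qed

text \<open>For fixed \<open>a\<close> and \<open>b\<close> there are \<open>gcd b (n div a)\<close>
  admissible \<open>s\<close>; passing from \<open>a\<close> to the complementary divisor makes the
  sum symmetric.\<close>

lemma card_subgroups_Z_square:
  assumes "n > 0"
  shows "real (card (subgroups_of (Z_square n))) = (\<Sum>a | a dvd n. \<Sum>b | b dvd n. real (gcd a b))"
proof -
  have "card (subgroups_of (Z_square n)) = card (hnf_params n)"
    using bij_betw_same_card[OF bij_betw_hnf_params_subgroups[OF assms]] by simp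
  also have "\<dots> = (\<Sum>a | a dvd n. \<Sum>b | b dvd n. card {s \<in> {0..<int b}. int b dvd int (n div a) * s})"
  proof -
    define D and S where "D = {d. d dvd n}" and "S = (\<lambda>a b. {s \<in> {0..<int b}. int b dvd int (n div a) * s})"
    have "finite D" using assms by (simp add: D_def)
    moreover have "finite (S a b)" for a b
      by (rule finite_subset[of _ "{0..<int b}"]) (auto simp: S_def)
    ultimately have "card (SIGMA a:D. SIGMA b:D. S a b) = (\<Sum>a\<in>D. \<Sum>b\<in>D. card (S a b))" by simp
    then show ?thesis by (simp only: hnf_params_def D_def S_def)
  qed
  also have "\<dots> = (\<Sum>a | a dvd n. \<Sum>b | b dvd n. gcd b (n div a))"
    using assms by (intro sum.cong refl card_mod_solutions) (auto intro: dvd_pos_nat)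
  also have "\<dots> = (\<Sum>a | a dvd n. \<Sum>b | b dvd n. gcd a b)"
    by (rule sum.reindex_bij_witness[of _ "\<lambda>a. n div a" "\<lambda>a. n div a"])
      (use assms in \<open>auto simp: gcd.commute\<close>)
  finally show ?thesis by simp
qed

section \<open>Prime powers and Moebius inversion\<close>

definition num_cyclic :: "nat \<Rightarrow> real" where
  "num_cyclic n = (\<Sum>d | d dvd n. jordan2 d / real (totient d))"

definition num_subgroups :: "nat \<Rightarrow> real" where
  "num_subgroups n = (\<Sum>a | a dvd n. \<Sum>b | b dvd n. real (gcd a b))"

lemma cdeg_square_eq: "n > 0 \<Longrightarrow> cdeg_square n = num_cyclic n / num_subgroups n"
  by (simp add: cdeg_square_def cdeg_def num_cyclic_def num_subgroups_def
      card_cyclic_subgroups_Z_square card_subgroups_Z_square)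

lemma multiplicative_fun_cong:
  assumes "multiplicative_fun f" "\<And>n. n > 0 \<Longrightarrow> g n = f n"
  shows "multiplicative_fun g"
  using assms by (simp add: multiplicative_fun_def)

lemma multiplicative_fun_cdeg_square: "multiplicative_fun cdeg_square"
proof (rule multiplicative_fun_cong)
  show "multiplicative_fun (\<lambda>n. num_cyclic n / num_subgroups n)"
    unfolding num_cyclic_def num_subgroups_def
    by (intro multiplicative_fun_divide multiplicative_fun_divisor_sum multiplicative_fun_jordan2
        multiplicative_fun_totient multiplicative_fun_gcd_sum)
qed (rule cdeg_square_eq)

lemma cdeg_square_1: "cdeg_square (Suc 0) = 1"
  using multiplicative_fun_1[OF multiplicative_fun_cdeg_square] .

lemma num_cyclic_1: "num_cyclic (Suc 0) = 1"
  by (simp add: num_cyclic_def multiplicative_fun_1[OF multiplicative_fun_jordan2])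

lemma num_subgroups_1: "num_subgroups (Suc 0) = 1"
  by (simp add: num_subgroups_def)

text \<open>The increment is the summand at \<open>p ^ Suc k\<close>, the quotient of
  \<open>p ^ (2 * k) * (p ^ 2 - 1)\<close> by \<open>p ^ k * (p - 1)\<close>.\<close>

lemma num_cyclic_prime_power_step:
  assumes "prime p"
  shows "num_cyclic (p ^ Suc k) = num_cyclic (p ^ k) + real p ^ Suc k + real p ^ k"
proof -
  have p: "real p > 1" using prime_gt_1_nat[OF assms] by simp
  have t: "real (totient (p ^ Suc k)) = real p ^ k * (real p - 1)"
    using assms p by (simp add: totient_prime_power_Suc of_nat_diff del: power_Suc)
  have "jordan2 (p ^ Suc k) = (real p ^ k * (real p - 1)) * (real p ^ Suc k + real p ^ k)"
    unfolding jordan2_prime_power_Suc[OF assms] by (simp add: algebra_simps power_mult power2_eq_square flip: power_mult_distrib power_add mult_2)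
  then have "jordan2 (p ^ Suc k) / real (totient (p ^ Suc k)) = real p ^ Suc k + real p ^ k"
    unfolding t using p by (subst nonzero_divide_eq_eq) (auto simp: mult.commute)
  then show ?thesis
    using assms by (simp add: num_cyclic_def sum_divisors_prime_power del: power_Suc)
qed

text \<open>Consecutive increments have ratio \<open>p\<close>, so
  \<open>num_cyclic (p ^ Suc k) - p * num_cyclic (p ^ k)\<close> does not depend on
  \<open>k\<close>; at \<open>k = 0\<close> it is 2.\<close>

lemma num_cyclic_prime_power_Suc:
  assumes "prime p"
  shows "num_cyclic (p ^ Suc k) = real p * num_cyclic (p ^ k) + 2"
proof (induction k)
  case 0
  then show ?case using num_cyclic_prime_power_step[OF assms, of 0] by (simp add: num_cyclic_1)
next
  case (Suc k)
  then show ?case using num_cyclic_prime_power_step[OF assms, of "Suc k"] num_cyclic_prime_power_step[OF assms, of k]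
    by (simp add: algebra_simps)
qed

text \<open>Of the exponent pairs up to \<open>k + 1\<close>, the \<open>2 * k + 3\<close> pairs
  with a zero entry have gcd 1. Every other gcd is \<open>p\<close> times the gcd for both exponents
  lowered by one.\<close>

lemma num_subgroups_prime_power_Suc:
  assumes "prime p"
  shows "num_subgroups (p ^ Suc k) = real p * num_subgroups (p ^ k) + (2 * real k + 3)"
proof -
  have eq: "num_subgroups (p ^ k) = (\<Sum>i\<le>k. \<Sum>j\<le>k. real (gcd (p ^ i) (p ^ j)))" for k
    using assms by (simp add: num_subgroups_def sum_divisors_prime_power)
  have 1: "(\<Sum>j\<le>Suc k. real (gcd (p ^ Suc i) (p ^ j))) = 1 + real p * (\<Sum>j\<le>k. real (gcd (p ^ i) (p ^ j)))" for i
    by (simp add: sum.atMost_Suc_shift sum_distrib_left gcd_mult_left del: sum.atMost_Suc)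
  have "num_subgroups (p ^ Suc k) = (real k + 2) + (\<Sum>i\<le>k. \<Sum>j\<le>Suc k. real (gcd (p ^ Suc i) (p ^ j)))"
    unfolding eq by (subst sum.atMost_Suc_shift) simp
  also have "\<dots> = (real k + 2) + (real k + 1) + real p * num_subgroups (p ^ k)"
    unfolding 1 eq by (simp add: sum.distrib sum_distrib_left)
  finally show ?thesis by simp
qed

text \<open>All three bounds pass along the recursions, the middle one because
  \<open>2 <= 2 * k + 3\<close>. The last one provides the saving in \<open>p\<close> when dividing
  by the number of subgroups.\<close>

lemma num_cyclic_le_num_subgroups:
  assumes "prime p"
  shows "0 < num_cyclic (p ^ k) \<and> num_cyclic (p ^ k) \<le> num_subgroups (p ^ k) \<and> real p ^ k \<le> num_subgroups (p ^ k)"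
proof (induction k)
  case 0
  then show ?case by (simp add: num_cyclic_1 num_subgroups_1)
next
  case (Suc k)
  have p: "real p > 0" using prime_gt_0_nat[OF assms] by simp
  have "0 < real p * num_cyclic (p ^ k)" using p Suc by simp
  moreover have "real p * num_cyclic (p ^ k) \<le> real p * num_subgroups (p ^ k)"
    "real p * real p ^ k \<le> real p * num_subgroups (p ^ k)"
    using p Suc by simp_all
  ultimately show ?case
    unfolding num_cyclic_prime_power_Suc[OF assms] num_subgroups_prime_power_Suc[OF assms] by simp
qed

lemma cdeg_square_prime_power:
  assumes "prime p"
  shows "0 < cdeg_square (p ^ k)" "cdeg_square (p ^ k) \<le> 1"
proof -
  have "p ^ k > 0" using assms prime_gt_0_nat by simp
  then show "0 < cdeg_square (p ^ k)" "cdeg_square (p ^ k) \<le> 1"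
    using num_cyclic_le_num_subgroups[OF assms, of k] by (auto simp: cdeg_square_eq)
qed

text \<open>Over the common denominator \<open>L * L'\<close> the terms with factor \<open>p\<close>
  cancel, leaving the numerator \<open>2 * L - (2 * k + 3) * C\<close>. As
  \<open>0 < C <= L\<close>, this is at most \<open>(2 * k + 3) * L\<close> in size, and
  \<open>L'\<close> is at least \<open>p ^ Suc k\<close>.\<close>

lemma cdeg_square_prime_power_diff:
  assumes "prime p"
  shows "\<bar>cdeg_square (p ^ Suc k) - cdeg_square (p ^ k)\<bar> \<le> (2 * real k + 3) / real p ^ Suc k"
proof -
  define C L L' where "C = num_cyclic (p ^ k)" and "L = num_subgroups (p ^ k)" and "L' = num_subgroups (p ^ Suc k)"
  have CL: "0 < C" "C \<le> L" and pk: "real p ^ k \<le> L"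
    using num_cyclic_le_num_subgroups[OF assms, of k] by (auto simp: C_def L_def)
  have L': "L' = real p * L + (2 * real k + 3)"
    unfolding L'_def L_def by (rule num_subgroups_prime_power_Suc[OF assms])
  have L'_ge: "real p ^ Suc k \<le> L'"
    using num_cyclic_le_num_subgroups[OF assms, of "Suc k"] by (simp add: L'_def)
  have p: "real p > 0" using prime_gt_0_nat[OF assms] by simp
  have pos: "L > 0" "L' > 0" using CL L'_ge p by (simp_all add: less_le_trans[of _ "real p ^ Suc k"])
  have f: "cdeg_square (p ^ k) = C / L" "cdeg_square (p ^ Suc k) = (real p * C + 2) / L'"
    using p num_cyclic_prime_power_Suc[OF assms, of k]
    by (simp_all add: cdeg_square_eq C_def L_def L'_def del: power_Suc)
  have "cdeg_square (p ^ Suc k) - cdeg_square (p ^ k) = (2 * L - (2 * real k + 3) * C) / (L * L')"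
    unfolding f using pos by (simp add: field_simps L')
  moreover have "\<bar>2 * L - (2 * real k + 3) * C\<bar> \<le> (2 * real k + 3) * L"
  proof -
    have "0 \<le> real k * L" "0 \<le> real k * C" "real k * C \<le> real k * L" 
      using CL by (simp_all add: mult_left_mono)
    then have "2 * L - (2 * real k + 3) * C \<le> (2 * real k + 3) * L" "- (2 * L - (2 * real k + 3) * C) \<le> (2 * real k + 3) * L"
      using CL unfolding distrib_right mult.assoc by linarith+
    then show ?thesis by linarith
  qed
  then have "\<bar>2 * L - (2 * real k + 3) * C\<bar> / (L * L') \<le> ((2 * real k + 3) * L) / (L * L')"
    using pos by (intro divide_right_mono) simp_all
  moreover have "((2 * real k + 3) * L) / (L * L') = (2 * real k + 3) / L'"
    using pos by simp
  moreover have "(2 * real k + 3) / L' \<le> (2 * real k + 3) / real p ^ Suc k"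
    using L'_ge p pos by (intro divide_left_mono) simp_all
  ultimately show ?thesis using pos by simp
qed

section \<open>The Moebius transform and its majorant\<close>

definition cdeg_moebius :: "nat \<Rightarrow> real" where
  "cdeg_moebius = prime_power_prod (\<lambda>p k. cdeg_square (p ^ k) - cdeg_square (p ^ (k - 1)))"

lemma multiplicative_fun_cdeg_moebius: "multiplicative_fun cdeg_moebius"
  by (simp add: cdeg_moebius_def multiplicative_fun_prime_power_prod)

lemma cdeg_moebius_prime_power_Suc:
  "prime p \<Longrightarrow> cdeg_moebius (p ^ Suc k) = cdeg_square (p ^ Suc k) - cdeg_square (p ^ k)"
  unfolding cdeg_moebius_def by (subst prime_power_prod_prime_power) simp_all

lemma cdeg_moebius_divisor_sum:
  assumes "n > 0"
  shows "(\<Sum>d | d dvd n. cdeg_moebius d) = cdeg_square n"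
proof (rule multiplicative_fun_eqI[OF _ _ assms])
  fix p k :: nat assume p: "prime p"
  have "(\<Sum>i\<le>k. cdeg_moebius (p ^ i)) = cdeg_square (p ^ k)"
    by (induction k) (use p in \<open>auto simp: cdeg_moebius_prime_power_Suc cdeg_square_1
        multiplicative_fun_1[OF multiplicative_fun_cdeg_moebius] simp del: power_Suc\<close>)
  then show "(\<Sum>d | d dvd p ^ k. cdeg_moebius d) = cdeg_square (p ^ k)"
    using p by (simp add: sum_divisors_prime_power)
qed (intro multiplicative_fun_divisor_sum multiplicative_fun_cdeg_moebius multiplicative_fun_cdeg_square)+

text \<open>The iterated form lets the general facts on divisor sums be applied twice, for
  multiplicativity and for logarithmic averages.\<close>

definition divisor3 :: "nat \<Rightarrow> real" where
  "divisor3 n = (\<Sum>d | d dvd n. \<Sum>e | e dvd d. 1)"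

lemma multiplicative_fun_divisor3: "multiplicative_fun divisor3"
proof -
  have "multiplicative_fun (\<lambda>n. 1)" by (simp add: multiplicative_fun_def)
  then show ?thesis
    unfolding divisor3_def by (intro multiplicative_fun_divisor_sum)
qed

lemma divisor3_nonneg: "divisor3 n \<ge> 0"
  by (simp add: divisor3_def sum_nonneg)

lemma divisor3_prime_power:
  assumes "prime p"
  shows "divisor3 (p ^ k) = (real k + 1) * (real k + 2) / 2"
proof -
  have "divisor3 (p ^ k) = (\<Sum>i\<le>k. real i + 1)"
    by (simp only: divisor3_def sum_divisors_prime_power[OF assms]) (simp add: add.commute)
  also have "\<dots> = (real k + 1) * (real k + 2) / 2"
    by (induction k) (simp_all add: field_simps)
  finally show ?thesis .
qed

lemma abs_cdeg_moebius_le: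
  assumes "n > 0"
  shows "\<bar>cdeg_moebius n\<bar> \<le> divisor3 n / real n"
proof (rule multiplicative_fun_abs_le[OF multiplicative_fun_cdeg_moebius _ assms])
  show "multiplicative_fun (\<lambda>n. divisor3 n / real n)"
    by (intro multiplicative_fun_divide multiplicative_fun_divisor3 multiplicative_fun_of_nat)
next
  fix p k :: nat assume p: "prime p" and "k > 0"
  then obtain j where k: "k = Suc j" by (cases k) auto
  have "\<bar>cdeg_moebius (p ^ k)\<bar> \<le> (2 * real j + 3) / real p ^ Suc j"
    using cdeg_square_prime_power_diff[OF p, of j] p by (simp add: k cdeg_moebius_prime_power_Suc del: power_Suc)
  \<comment> \<open>The numerators differ by \<open>k * (k - 1) / 2\<close>, so they are equal at
    \<open>k = 1\<close>.\<close>
  also have "\<dots> \<le> ((real k + 1) * (real k + 2) / 2) / real p ^ Suc j"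
    by (intro divide_right_mono) (simp_all add: k field_simps)
  also have "(real k + 1) * (real k + 2) / 2 = divisor3 (p ^ k)"
    using divisor3_prime_power[OF p] by simp
  also have "real p ^ Suc j = real (p ^ k)" by (simp add: k)
  finally show "\<bar>cdeg_moebius (p ^ k)\<bar> \<le> divisor3 (p ^ k) / real (p ^ k)" .
qed

section \<open>The summatory function\<close>

text \<open>The difference between the harmonic number and the logarithm decreases from its value 1
  at \<open>n = 1\<close>.\<close>

lemma harm_le_ln:
  assumes "n > 0"
  shows "harm n \<le> 1 + ln (real n)"
proof -
  obtain m where m: "n = Suc m" using assms by (cases n) auto
  have "harm (Suc m) - ln (real (Suc m)) \<le> harm (Suc 0) - ln (real (Suc 0))"
    using decseqD[OF decseq_harm_diff_ln, of 0 m] by simp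
  then show ?thesis by (simp add: m harm_expand)
qed

text \<open>Substitution \<open>n = d * m\<close>: for fixed \<open>d\<close> the cofactor
  \<open>m\<close> runs up to \<open>N div d\<close>.\<close>

lemma sum_divisors_swap:
  fixes F :: "nat \<Rightarrow> nat \<Rightarrow> real"
  shows "(\<Sum>n\<in>{1..N}. \<Sum>d | d dvd n. F d (n div d)) = (\<Sum>d\<in>{1..N}. \<Sum>m\<in>{1..N div d}. F d m)"
proof -
  have "(\<Sum>n\<in>{1..N}. \<Sum>d | d dvd n. F d (n div d)) = (\<Sum>(n, d)\<in>(SIGMA n:{1..N}. {d. d dvd n}). F d (n div d))"
    by (rule sum.Sigma) auto
  also have "\<dots> = (\<Sum>(d, m)\<in>(SIGMA d:{1..N}. {1..N div d}). F d m)"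
  proof (rule sum.reindex_bij_witness[of _ "\<lambda>(d, m). (d * m, d)" "\<lambda>(n, d). (d, n div d)"], goal_cases)
    case (2 a)
    then obtain n d where a: "a = (n, d)" "n \<ge> 1" "n \<le> N" "d dvd n" by auto
    then have "d \<ge> 1" "d \<le> n" by (auto simp: dvd_imp_le Suc_le_eq intro: dvd_pos_nat)
    moreover have "n div d \<ge> 1" using calculation by (simp add: div_greater_zero_iff Suc_le_eq)
    ultimately show ?case using a by (auto simp: div_le_mono)
  next
    case (4 b)
    then show ?case by (auto simp: less_eq_div_iff_mult_less_eq mult.commute)
  qed auto
  also have "\<dots> = (\<Sum>d\<in>{1..N}. \<Sum>m\<in>{1..N div d}. F d m)"
    by (rule sum.Sigma[symmetric]) auto
  finally show ?thesis .
qed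

text \<open>With \<open>n = d * m\<close> the weight \<open>1 / n\<close> splits, and the sum over
  \<open>m\<close> is a harmonic number of index at most \<open>N\<close>. Each convolution with the
  constant 1 thus costs one logarithm.\<close>

lemma sum_divisor_sum_over_n_le:
  fixes A :: "nat \<Rightarrow> real"
  assumes "\<And>n. A n \<ge> 0"
  shows "(\<Sum>n\<in>{1..N}. (\<Sum>d | d dvd n. A d) / real n) \<le> harm N * (\<Sum>d\<in>{1..N}. A d / real d)"
proof -
  have "(\<Sum>n\<in>{1..N}. (\<Sum>d | d dvd n. A d) / real n)
      = (\<Sum>n\<in>{1..N}. \<Sum>d | d dvd n. A d / (real d * real (n div d)))"
  proof (intro sum.cong refl)
    fix n
    have "real n = real d * real (n div d)" if "d dvd n" for d
      using that by (simp flip: of_nat_mult)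
    then show "(\<Sum>d | d dvd n. A d) / real n = (\<Sum>d | d dvd n. A d / (real d * real (n div d)))"
      unfolding sum_divide_distrib by (intro sum.cong refl) (metis mem_Collect_eq)
  qed
  also have "\<dots> = (\<Sum>d\<in>{1..N}. \<Sum>m\<in>{1..N div d}. A d / (real d * real m))"
    by (rule sum_divisors_swap)
  also have "\<dots> = (\<Sum>d\<in>{1..N}. A d / real d * harm (N div d))"
    by (simp add: harm_def sum_distrib_left divide_inverse mult.assoc)
  also have "\<dots> \<le> (\<Sum>d\<in>{1..N}. A d / real d * harm N)"
    by (intro sum_mono mult_left_mono harm_mono) (simp_all add: assms)
  finally show ?thesis by (simp add: sum_distrib_left mult.commute)
qed

lemma sum_divisor3_over_n_le:
  assumes "N > 0"
  shows "(\<Sum>n\<in>{1..N}. divisor3 n / real n) \<le> (1 + ln (real N)) ^ 3"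
proof -
  have h: "(harm N :: real) \<ge> 0" by (rule harm_nonneg)
  have "(\<Sum>n\<in>{1..N}. divisor3 n / real n) \<le> harm N * (\<Sum>d\<in>{1..N}. (\<Sum>e | e dvd d. 1) / real d)"
    unfolding divisor3_def by (rule sum_divisor_sum_over_n_le) simp
  also have "\<dots> \<le> harm N * (harm N * (\<Sum>d\<in>{1..N}. 1 / real d))"
    by (intro mult_left_mono h sum_divisor_sum_over_n_le) simp
  also have "\<dots> = harm N ^ 3"
    by (simp add: harm_def inverse_eq_divide power3_eq_cube)
  also have "\<dots> \<le> (1 + ln (real N)) ^ 3"
    by (intro power_mono harm_le_ln assms h)
  finally show ?thesis .
qed

section \<open>Tail sums by dyadic blocks\<close>

definition tail_const :: real where
  "tail_const = (\<Sum>k. (real k + 2) ^ 3 / 2 ^ k)"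

lemma summable_tail_const: "summable (\<lambda>k. (real k + 2) ^ 3 / 2 ^ k)"
proof (rule summable_comparison_test_bigo)
  \<comment> \<open>Any ratio strictly between 1/2 and 1 absorbs the cubic factor; 2/3 is
    taken.\<close>
  show "summable (\<lambda>n. norm (1 / (3 / 2) ^ n :: real))"
    using summable_geometric[of "2 / 3 :: real"] by (simp add: power_divide)
  show "(\<lambda>k. (real k + 2) ^ 3 / 2 ^ k) \<in> O(\<lambda>k. 1 / (3 / 2) ^ k)" by real_asymp
qed

lemma tail_const_nonneg: "tail_const \<ge> 0"
  unfolding tail_const_def by (intro suminf_nonneg summable_tail_const) simp

text \<open>On the block from \<open>A = 2 ^ k * N\<close> to \<open>2 * A\<close>, one factor
  \<open>1 / d\<close> is at most \<open>1 / A\<close>, and the rest is an average already bounded.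
  The index \<open>k\<close> separates through
  \<open>1 + ln (2 * A) <= (1 + ln N) * (k + 2)\<close>, which uses \<open>ln 2 < 1\<close>.\<close>

lemma sum_divisor3_over_square_dyadic:
  assumes "N > 0"
  shows "(\<Sum>d\<in>{2 ^ k * N<..2 ^ Suc k * N}. divisor3 d / real d ^ 2)
    \<le> (1 + ln (real N)) ^ 3 / real N * ((real k + 2) ^ 3 / 2 ^ k)"
proof -
  define A where "A = 2 ^ k * N"
  have A: "A > 0" using assms by (simp add: A_def)
  have "(\<Sum>d\<in>{A<..2 * A}. divisor3 d / real d ^ 2) \<le> (\<Sum>d\<in>{A<..2 * A}. divisor3 d / real d * (1 / real A))"
  proof (intro sum_mono)
    fix d assume "d \<in> {A<..2 * A}"
    then have d: "real A \<le> real d" "d > 0" by auto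
    have "divisor3 d / real d * (1 / real d) \<le> divisor3 d / real d * (1 / real A)"
      using d A by (intro mult_left_mono divide_left_mono) (simp_all add: divisor3_nonneg)
    then show "divisor3 d / real d ^ 2 \<le> divisor3 d / real d * (1 / real A)"
      by (simp add: power2_eq_square)
  qed
  also have "\<dots> = (\<Sum>d\<in>{A<..2 * A}. divisor3 d / real d) * (1 / real A)"
    by (rule sum_distrib_right[symmetric])
  also have "\<dots> \<le> (\<Sum>d\<in>{1..2 * A}. divisor3 d / real d) * (1 / real A)"
    by (intro mult_right_mono sum_mono2) (auto simp: divisor3_nonneg)
  also have "\<dots> \<le> (1 + ln (real (2 * A))) ^ 3 * (1 / real A)"
    using A by (intro mult_right_mono sum_divisor3_over_n_le) auto
  also have "\<dots> \<le> ((1 + ln (real N)) * (real k + 2)) ^ 3 * (1 / real A)"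
  proof (intro mult_right_mono power_mono)
    have N: "ln (real N) \<ge> 0" using assms by simp
    have "ln (real (2 * A)) = (real k + 1) * ln 2 + ln (real N)"
      using assms by (simp add: A_def ln_mult ln_realpow algebra_simps)
    also have "\<dots> \<le> (real k + 1) * 1 + ln (real N)"
      using ln_2_less_1 by (intro add_mono mult_left_mono) auto
    finally have "1 + ln (real (2 * A)) \<le> (real k + 2) + ln (real N) * 1" by simp
    also have "\<dots> \<le> (real k + 2) + ln (real N) * (real k + 2)"
      using N by (intro add_left_mono mult_left_mono) auto
    finally show "1 + ln (real (2 * A)) \<le> (1 + ln (real N)) * (real k + 2)"
      by (simp add: algebra_simps)
    show "0 \<le> 1 + ln (real (2 * A))" using A by (intro add_nonneg_nonneg ln_ge_zero) auto
  qed simp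
  also have "\<dots> = (1 + ln (real N)) ^ 3 / real N * ((real k + 2) ^ 3 / 2 ^ k)"
    by (simp add: A_def power_mult_distrib)
  finally show ?thesis by (simp add: A_def mult.assoc)
qed

lemma sum_divisor3_over_square_le:
  assumes "N > 0"
  shows "(\<Sum>d\<in>{N<..M}. divisor3 d / real d ^ 2) \<le> tail_const * (1 + ln (real N)) ^ 3 / real N"
proof -
  define B where "B = (1 + ln (real N)) ^ 3 / real N"
  have B: "B \<ge> 0" using assms by (simp add: B_def)
  have blocks: "(\<Sum>d\<in>{N<..2 ^ J * N}. divisor3 d / real d ^ 2) \<le> B * (\<Sum>k<J. (real k + 2) ^ 3 / 2 ^ k)" for J
  proof (induction J)
    case (Suc J)
    have "{N<..2 ^ Suc J * N} = {N<..2 ^ J * N} \<union> {2 ^ J * N<..2 ^ Suc J * N}"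
      by (rule ivl_disj_un_two(6)[symmetric]) auto
    then have "(\<Sum>d\<in>{N<..2 ^ Suc J * N}. divisor3 d / real d ^ 2) =
        (\<Sum>d\<in>{N<..2 ^ J * N}. divisor3 d / real d ^ 2) + (\<Sum>d\<in>{2 ^ J * N<..2 ^ Suc J * N}. divisor3 d / real d ^ 2)"
      by (simp only:) (rule sum.union_disjoint; auto)
    also have "\<dots> \<le> B * (\<Sum>k<J. (real k + 2) ^ 3 / 2 ^ k) + B * ((real J + 2) ^ 3 / 2 ^ J)"
      using sum_divisor3_over_square_dyadic[OF assms, of J] Suc by (intro add_mono) (simp_all add: B_def)
    finally show ?case by (simp add: distrib_left)
  qed simp
  \<comment> \<open>\<open>M\<close> blocks suffice to reach \<open>M\<close>, and the bound does
    not depend on their number.\<close>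
  have "M \<le> 2 ^ M * N"
    using assms less_exp[of M] by (metis Suc_leI less_imp_le mult.right_neutral mult_le_mono One_nat_def)
  then have "(\<Sum>d\<in>{N<..M}. divisor3 d / real d ^ 2) \<le> (\<Sum>d\<in>{N<..2 ^ M * N}. divisor3 d / real d ^ 2)"
    by (intro sum_mono2) (auto simp: divisor3_nonneg)
  also have "\<dots> \<le> B * (\<Sum>k<M. (real k + 2) ^ 3 / 2 ^ k)" by (rule blocks)
  also have "\<dots> \<le> B * tail_const"
    unfolding tail_const_def by (intro mult_left_mono B sum_le_suminf summable_tail_const) auto
  finally show ?thesis by (simp add: B_def mult.commute)
qed

text \<open>The tail bound at \<open>N = 1\<close>, where the logarithm vanishes, bounds all partial
  sums.\<close>

lemma summable_divisor3_over_square: "summable (\<lambda>d. divisor3 d / real d ^ 2)"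
proof (rule summableI_nonneg_bounded)
  fix n
  have "(\<Sum>d<n. divisor3 d / real d ^ 2) \<le> (\<Sum>d\<in>{0, 1} \<union> {1<..n}. divisor3 d / real d ^ 2)"
    by (rule sum_mono2) (auto simp: divisor3_nonneg)
  also have "\<dots> = divisor3 1 + (\<Sum>d\<in>{1<..n}. divisor3 d / real d ^ 2)"
    by (subst sum.union_disjoint) auto
  also have "\<dots> \<le> divisor3 1 + tail_const"
    using sum_divisor3_over_square_le[of 1 n] by simp
  finally show "(\<Sum>d<n. divisor3 d / real d ^ 2) \<le> divisor3 1 + tail_const" .
qed (simp add: divisor3_nonneg)

lemma suminf_divisor3_tail_le:
  assumes "N > 0"
  shows "(\<Sum>d. divisor3 (d + Suc N) / real (d + Suc N) ^ 2) \<le> tail_const * (1 + ln (real N)) ^ 3 / real N"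
proof (rule suminf_le_const)
  show "summable (\<lambda>d. divisor3 (d + Suc N) / real (d + Suc N) ^ 2)"
    using summable_ignore_initial_segment[OF summable_divisor3_over_square] .
  fix n
  have "(\<Sum>d<n. divisor3 (d + Suc N) / real (d + Suc N) ^ 2) = (\<Sum>d\<in>{N<..N + n}. divisor3 d / real d ^ 2)"
    by (rule sum.reindex_bij_witness[of _ "\<lambda>d. d - Suc N" "\<lambda>d. d + Suc N"]) auto
  then show "(\<Sum>d<n. divisor3 (d + Suc N) / real (d + Suc N) ^ 2) \<le> tail_const * (1 + ln (real N)) ^ 3 / real N"
    using sum_divisor3_over_square_le[OF assms] by simp
qed

section \<open>Error terms of the summatory function\<close>

definition cdeg_moebius_series :: real where
  "cdeg_moebius_series = (\<Sum>n. cdeg_moebius n / real n)"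

lemma abs_cdeg_moebius_over_n_le: "\<bar>cdeg_moebius n / real n\<bar> \<le> divisor3 n / real n ^ 2"
proof (cases "n = 0")
  case False
  then have "\<bar>cdeg_moebius n\<bar> / real n \<le> (divisor3 n / real n) / real n"
    by (intro divide_right_mono abs_cdeg_moebius_le) auto
  then show ?thesis by (simp add: power2_eq_square)
qed simp

lemma summable_abs_cdeg_moebius: "summable (\<lambda>n. \<bar>cdeg_moebius n / real n\<bar>)"
  by (rule summable_comparison_test[OF _ summable_divisor3_over_square])
    (use abs_cdeg_moebius_over_n_le in auto)

text \<open>In the constant, 1 pays for replacing \<open>N div d\<close> by \<open>N / d\<close>,
  which changes each term by at most \<open>divisor3 d / d\<close>; \<open>tail_const\<close> pays
  for \<open>N\<close> times the tail of the series.\<close>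

lemma sum_cdeg_square_nat:
  assumes "N > 0"
  shows "\<bar>(\<Sum>n\<in>{1..N}. cdeg_square n) - cdeg_moebius_series * real N\<bar> \<le> (1 + tail_const) * (1 + ln (real N)) ^ 3"
proof -
  let ?r = "\<lambda>n. cdeg_moebius n / real n"
  have sm: "summable ?r" using summable_abs_cdeg_moebius by (rule summable_rabs_cancel)
  have "(\<Sum>n\<in>{1..N}. cdeg_square n) = (\<Sum>n\<in>{1..N}. \<Sum>d | d dvd n. cdeg_moebius d)"
    by (intro sum.cong) (simp_all add: cdeg_moebius_divisor_sum)
  also have "\<dots> = (\<Sum>d\<in>{1..N}. \<Sum>m\<in>{1..N div d}. cdeg_moebius d)"
    by (rule sum_divisors_swap[of "\<lambda>d m. cdeg_moebius d"])
  also have "\<dots> = (\<Sum>d\<in>{1..N}. cdeg_moebius d * real (N div d))" by (simp add: mult.commute)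
  finally have S: "(\<Sum>n\<in>{1..N}. cdeg_square n) = (\<Sum>d\<in>{1..N}. cdeg_moebius d * real (N div d))" .
  have "cdeg_moebius_series = (\<Sum>d. ?r (d + Suc N)) + (\<Sum>d<Suc N. ?r d)"
    unfolding cdeg_moebius_series_def by (rule suminf_split_initial_segment[OF sm])
  \<comment> \<open>\<open>?r 0\<close> is 0 by the convention for division by zero, although
    \<open>cdeg_moebius 0\<close> is 1.\<close>
  also have "(\<Sum>d<Suc N. ?r d) = (\<Sum>d\<in>{1..N}. ?r d)"
    by (intro sum.mono_neutral_right) (auto simp: not_le)
  finally have E: "cdeg_moebius_series = (\<Sum>d. ?r (d + Suc N)) + (\<Sum>d\<in>{1..N}. ?r d)" .
  have "\<bar>(\<Sum>d\<in>{1..N}. cdeg_moebius d * real (N div d)) - (\<Sum>d\<in>{1..N}. ?r d) * real N\<bar>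
      = \<bar>\<Sum>d\<in>{1..N}. cdeg_moebius d * (real (N div d) - real N / real d)\<bar>"
    by (simp add: sum_distrib_right right_diff_distrib sum_subtractf)
  also have "\<dots> \<le> (\<Sum>d\<in>{1..N}. \<bar>cdeg_moebius d * (real (N div d) - real N / real d)\<bar>)"
    by (rule sum_abs)
  also have "\<dots> \<le> (\<Sum>d\<in>{1..N}. divisor3 d / real d * 1)"
    unfolding abs_mult
  proof (intro sum_mono mult_mono)
    fix d assume d: "d \<in> {1..N}"
    then show "\<bar>cdeg_moebius d\<bar> \<le> divisor3 d / real d" by (intro abs_cdeg_moebius_le) auto
    show "\<bar>real (N div d) - real N / real d\<bar> \<le> 1"
    proof -
      have "real N = real d * real (N div d) + real (N mod d)" by (simp flip: of_nat_mult of_nat_add)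
      then have "real N / real d = real (N div d) + real (N mod d) / real d"
        using d by (simp add: field_simps)
      moreover have "real (N mod d) / real d \<le> 1" using d by (simp add: divide_le_eq less_imp_le)
      ultimately show ?thesis by simp
    qed
  qed (auto simp: divisor3_nonneg)
  also have "\<dots> \<le> (1 + ln (real N)) ^ 3" using sum_divisor3_over_n_le[OF assms] by simp
  finally have 1: "\<bar>(\<Sum>d\<in>{1..N}. cdeg_moebius d * real (N div d)) - (\<Sum>d\<in>{1..N}. ?r d) * real N\<bar> \<le> (1 + ln (real N)) ^ 3" .
  have sm': "summable (\<lambda>d. \<bar>?r (d + Suc N)\<bar>)"
    using summable_ignore_initial_segment[OF summable_abs_cdeg_moebius] .
  have "\<bar>\<Sum>d. ?r (d + Suc N)\<bar> \<le> (\<Sum>d. \<bar>?r (d + Suc N)\<bar>)" by (rule summable_rabs[OF sm'])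
  also have "\<dots> \<le> (\<Sum>d. divisor3 (d + Suc N) / real (d + Suc N) ^ 2)"
    by (intro suminf_le abs_cdeg_moebius_over_n_le sm'
        summable_ignore_initial_segment[OF summable_divisor3_over_square])
  also have "\<dots> \<le> tail_const * (1 + ln (real N)) ^ 3 / real N"
    by (rule suminf_divisor3_tail_le[OF assms])
  finally have "\<bar>\<Sum>d. ?r (d + Suc N)\<bar> * real N \<le> tail_const * (1 + ln (real N)) ^ 3"
    using assms by (simp add: pos_le_divide_eq)
  then have 2: "\<bar>(\<Sum>d. ?r (d + Suc N)) * real N\<bar> \<le> tail_const * (1 + ln (real N)) ^ 3"
    by (simp add: abs_mult)
  show ?thesis using 1 2 unfolding S E distrib_right by linarith
qed

section \<open>The Euler product\<close>

lemma summable_cdeg_square_prime_powers: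
  assumes "prime p"
  shows "summable (\<lambda>a. cdeg_square (p ^ a) / real (p ^ a))"
proof (rule summable_comparison_test)
  have p: "real p > 1" using prime_gt_1_nat[OF assms] by simp
  show "summable (\<lambda>a. (1 / real p) ^ a)" using p by (intro summable_geometric) simp
  have "norm (cdeg_square (p ^ a) / real (p ^ a)) \<le> (1 / real p) ^ a" for a
    using cdeg_square_prime_power[OF assms, of a] p by (simp add: power_divide divide_right_mono)
  then show "\<exists>N. \<forall>a\<ge>N. norm (cdeg_square (p ^ a) / real (p ^ a)) \<le> (1 / real p) ^ a"
    by blast
qed

text \<open>Multiplication by \<open>1 - 1 / p\<close> produces the terms
  \<open>u (Suc a) - u a / p\<close>, which are the \<open>cdeg_moebius\<close> terms at positive
  exponents; \<open>u 0 = 1\<close> is the term at exponent 0.\<close>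

lemma local_factor_sums:
  assumes "prime p"
  shows "(\<lambda>a. cdeg_moebius (p ^ a) / real (p ^ a)) sums local_factor p"
proof -
  define u where "u = (\<lambda>a. cdeg_square (p ^ a) / real (p ^ a))"
  have p: "real p > 0" using prime_gt_0_nat[OF assms] by simp
  have u: "u sums (\<Sum>a. u a)"
    unfolding u_def by (rule summable_sums[OF summable_cdeg_square_prime_powers[OF assms]])
  then have "(\<lambda>a. u (Suc a)) sums ((\<Sum>a. u a) - u 0)" by (simp add: sums_Suc_iff)
  then have "(\<lambda>a. u (Suc a) - u a * (1 / real p)) sums ((\<Sum>a. u a) - u 0 - (\<Sum>a. u a) * (1 / real p))"
    by (intro sums_diff sums_mult2 u)
  moreover have "u (Suc a) - u a * (1 / real p) = cdeg_moebius (p ^ Suc a) / real (p ^ Suc a)" for a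
    unfolding cdeg_moebius_prime_power_Suc[OF assms] u_def using p by (simp add: field_simps)
  ultimately have "(\<lambda>a. cdeg_moebius (p ^ Suc a) / real (p ^ Suc a)) sums ((\<Sum>a. u a) - u 0 - (\<Sum>a. u a) * (1 / real p))"
    by simp
  moreover have "u 0 = cdeg_moebius (p ^ 0) / real (p ^ 0)"
    by (simp add: u_def cdeg_square_1 multiplicative_fun_1[OF multiplicative_fun_cdeg_moebius])
  ultimately have "(\<lambda>a. cdeg_moebius (p ^ a) / real (p ^ a)) sums ((\<Sum>a. u a) - (\<Sum>a. u a) * (1 / real p))"
    by (subst (asm) sums_Suc_iff) simp
  then show ?thesis by (simp add: local_factor_def u_def algebra_simps)
qed

text \<open>From \<open>2 * b + 3 <= 3 * p ^ b\<close> the numerator is at most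
  \<open>3 / p\<close>; the denominator \<open>p ^ Suc b >= p * 2 ^ b\<close> gives a second factor
  \<open>1 / p\<close> and geometric decay. The resulting \<open>1 / p ^ 2\<close> makes the Euler
  product converge.\<close>

lemma abs_cdeg_moebius_prime_power_Suc_le:
  assumes "prime p"
  shows "\<bar>cdeg_moebius (p ^ Suc b) / real (p ^ Suc b)\<bar> \<le> 3 / real p ^ 2 * (1 / 2) ^ b"
proof -
  have p: "real p \<ge> 2" using prime_ge_2_nat[OF assms] by simp
  have pb: "(2::real) ^ b \<le> real p ^ b" using p by (intro power_mono) auto
  have "2 * real b + 3 \<le> 3 * 2 ^ b" by (induction b) simp_all
  also have "\<dots> \<le> 3 * real p ^ b" using pb by simp
  finally have "(2 * real b + 3) / real p ^ Suc b \<le> (3 * real p ^ b) / real p ^ Suc b"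
    using p by (intro divide_right_mono) simp_all
  also have "\<dots> = 3 / real p" using p by simp
  finally have "\<bar>cdeg_moebius (p ^ Suc b)\<bar> \<le> 3 / real p"
    using cdeg_square_prime_power_diff[OF assms, of b]
    unfolding cdeg_moebius_prime_power_Suc[OF assms] by linarith
  then have "\<bar>cdeg_moebius (p ^ Suc b)\<bar> / real p ^ Suc b \<le> (3 / real p) / (real p * 2 ^ b)"
    using p pb by (intro frac_le) simp_all
  then show ?thesis
    by (simp add: power2_eq_square power_divide)
qed

lemma summable_abs_cdeg_moebius_prime_powers:
  assumes "prime p"
  shows "summable (\<lambda>a. \<bar>cdeg_moebius (p ^ a) / real (p ^ a)\<bar>)"
proof -
  have "summable (\<lambda>b. 3 / real p ^ 2 * (1 / 2) ^ b)"
    by (intro summable_mult summable_geometric) simp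
  then have "summable (\<lambda>b. \<bar>cdeg_moebius (p ^ Suc b) / real (p ^ Suc b)\<bar>)"
    by (rule summable_comparison_test[rotated])
      (use abs_cdeg_moebius_prime_power_Suc_le[OF assms] in auto)
  then show ?thesis by (subst (asm) summable_Suc_iff)
qed

text \<open>The term at exponent 0 is 1, and the geometric series of ratio 1/2 doubles the constant
  3.\<close>

lemma abs_local_factor_minus_1_le:
  assumes "prime p"
  shows "\<bar>local_factor p - 1\<bar> \<le> 6 / real p ^ 2"
proof -
  let ?r = "\<lambda>a. cdeg_moebius (p ^ a) / real (p ^ a)"
  have "?r 0 = 1" by (simp add: multiplicative_fun_1[OF multiplicative_fun_cdeg_moebius])
  then have s: "(\<lambda>b. ?r (Suc b)) sums (local_factor p - 1)"
    using local_factor_sums[OF assms] by (subst sums_Suc_iff) simp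
  have g: "(\<lambda>b. 3 / real p ^ 2 * (1 / 2) ^ b) sums (3 / real p ^ 2 * 2)"
    using sums_mult[OF geometric_sums[of "1 / 2 :: real"], of "3 / real p ^ 2"] by simp
  have sa: "summable (\<lambda>b. \<bar>?r (Suc b)\<bar>)"
    using summable_abs_cdeg_moebius_prime_powers[OF assms] by (subst summable_Suc_iff)
  have "\<bar>local_factor p - 1\<bar> = \<bar>\<Sum>b. ?r (Suc b)\<bar>" using sums_unique[OF s] by simp
  also have "\<dots> \<le> (\<Sum>b. \<bar>?r (Suc b)\<bar>)" by (rule summable_rabs[OF sa])
  also have "\<dots> \<le> (\<Sum>b. 3 / real p ^ 2 * (1 / 2) ^ b)"
    by (intro suminf_le sa sums_summable[OF g] abs_cdeg_moebius_prime_power_Suc_le[OF assms])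
  also have "\<dots> = 6 / real p ^ 2" using sums_unique[OF g] by simp
  finally show ?thesis .
qed

lemma convergent_prod_euler_factor: "convergent_prod euler_factor"
proof -
  have "summable (\<lambda>n. 6 * (1 / real n ^ 2))"
    using inverse_power_summable[of 2, where 'a = real]
    by (intro summable_mult) (simp add: inverse_eq_divide)
  then have "summable (\<lambda>n. norm (euler_factor n - 1))"
    by (rule summable_comparison_test[rotated])
      (use abs_local_factor_minus_1_le in \<open>auto simp: euler_factor_def\<close>)
  then show ?thesis
    by (intro abs_convergent_prod_imp_convergent_prod summable_imp_abs_convergent_prod)
qed

section \<open>Smooth numbers and partial Euler products\<close>

definition smooth_numbers :: "nat \<Rightarrow> nat set" where
  "smooth_numbers k = {n. n > 0 \<and> (\<forall>p. prime p \<longrightarrow> p dvd n \<longrightarrow> p \<le> k)}"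

text \<open>\<open>a\<close> is the multiplicity of the new prime and \<open>m\<close> the part free
  of it; exponent 0 gives the numbers that were smooth before.\<close>

lemma bij_betw_smooth_numbers_Suc:
  assumes "prime (Suc k)"
  shows "bij_betw (\<lambda>(m, a). m * Suc k ^ a) (smooth_numbers k \<times> UNIV) (smooth_numbers (Suc k))"
  unfolding bij_betw_def
proof
  let ?p = "Suc k"
  have nd: "\<not> ?p dvd m" if "m \<in> smooth_numbers k" for m
    using that assms by (auto simp: smooth_numbers_def)
  show "inj_on (\<lambda>(m, a). m * ?p ^ a) (smooth_numbers k \<times> UNIV)"
  proof (rule inj_onI, clarify)
    fix m a m' a' assume *: "m \<in> smooth_numbers k" "m' \<in> smooth_numbers k" "m * ?p ^ a = m' * ?p ^ a'"
    have mult: "multiplicity ?p (m * ?p ^ a) = a" if "m \<in> smooth_numbers k" for m a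
    proof (rule multiplicity_eqI)
      have "\<not> ?p * ?p ^ a dvd m * ?p ^ a"
        using nd[OF that] by (subst dvd_times_right_cancel_iff) auto
      then show "\<not> ?p ^ Suc a dvd m * ?p ^ a" unfolding power_Suc .
    qed simp
    have "a = a'" using mult[OF *(1), of a] mult[OF *(2), of a'] *(3) by simp
    then show "m = m' \<and> a = a'" using *(3) by simp
  qed
  show "(\<lambda>(m, a). m * ?p ^ a) ` (smooth_numbers k \<times> UNIV) = smooth_numbers ?p"
  proof (intro equalityI subsetI)
    fix n assume n: "n \<in> smooth_numbers ?p"
    then have n0: "n \<noteq> 0" by (simp add: smooth_numbers_def)
    obtain m where m: "n = ?p ^ multiplicity ?p n * m" "\<not> ?p dvd m"
      using multiplicity_decompose'[OF n0, of ?p] assms by (metis not_prime_unit)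
    have "m \<in> smooth_numbers k"
      unfolding smooth_numbers_def
    proof (intro CollectI conjI allI impI)
      show "m > 0" using m(1) n0 by (cases m) auto
      fix q assume q: "prime q" "q dvd m"
      then have "q dvd n" using m(1) by (metis dvd_mult)
      then have "q \<le> ?p" using n q(1) by (simp add: smooth_numbers_def)
      moreover have "q \<noteq> ?p" using q(2) m(2) by auto
      ultimately show "q \<le> k" by simp
    qed
    then show "n \<in> (\<lambda>(m, a). m * ?p ^ a) ` (smooth_numbers k \<times> UNIV)"
      using m(1) by (intro image_eqI[of _ _ "(m, multiplicity ?p n)"]) (auto simp: mult.commute)
  next
    fix n assume "n \<in> (\<lambda>(m, a). m * ?p ^ a) ` (smooth_numbers k \<times> UNIV)"
    then obtain m a where m: "m \<in> smooth_numbers k" "n = m * ?p ^ a" by auto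
    have "q \<le> ?p" if "prime q" "q dvd n" for q
    proof -
      have "q dvd m \<or> q dvd ?p" using that m(2) by (metis prime_dvd_mult_iff prime_dvd_power)
      then show ?thesis using m(1) that(1) by (auto simp: smooth_numbers_def le_SucI dvd_imp_le)
    qed
    then show "n \<in> smooth_numbers ?p" using m by (auto simp: smooth_numbers_def)
  qed
qed

text \<open>Induction on \<open>k\<close>: a non-prime \<open>Suc k\<close> changes neither side,
  and for a prime one multiplicativity factors the sum over pairs of a smooth number and an
  exponent.\<close>

lemma has_sum_smooth_numbers:
  "((\<lambda>n. cdeg_moebius n / real n) has_sum (\<Prod>i\<le>k. euler_factor i)) (smooth_numbers k)"
proof (induction k)
  case 0
  have "n = 1" if "n > 0" "\<And>p. prime p \<Longrightarrow> \<not> p dvd n" for n :: nat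
    using that prime_factor_nat by blast
  then have "smooth_numbers 0 = {1}"
    by (auto simp: smooth_numbers_def prime_gt_0_nat)
  then show ?case
    by (simp add: euler_factor_def multiplicative_fun_1[OF multiplicative_fun_cdeg_moebius] has_sum_finite_iff)
next
  case (Suc k)
  let ?r = "\<lambda>n. cdeg_moebius n / real n"
  show ?case
  proof (cases "prime (Suc k)")
    case False
    then have "smooth_numbers (Suc k) = smooth_numbers k"
      by (auto simp: smooth_numbers_def le_Suc_eq)
    then show ?thesis using Suc False by (simp add: euler_factor_def)
  next
    case True
    let ?p = "Suc k" and ?h = "\<lambda>(m, a). m * Suc k ^ a"
    have bij: "bij_betw ?h (smooth_numbers k \<times> UNIV) (smooth_numbers ?p)"
      by (rule bij_betw_smooth_numbers_Suc[OF True])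
    have mult: "multiplicative_fun ?r"
      by (intro multiplicative_fun_divide multiplicative_fun_cdeg_moebius multiplicative_fun_of_nat)
    have r: "(?r \<circ> ?h) (m, a) = ?r m * ?r (?p ^ a)" if "m \<in> smooth_numbers k" for m a
    proof -
      have "\<not> ?p dvd m" using that True by (auto simp: smooth_numbers_def)
      then have "coprime ?p m" using True by (intro prime_imp_coprime)
      then have "coprime m (?p ^ a)" by (simp only: coprime_power_right_iff coprime_commute[of m]) simp
      then have "?r (m * ?p ^ a) = ?r m * ?r (?p ^ a)"
        using that by (intro multiplicative_fun_coprime[OF mult]) (auto simp: smooth_numbers_def)
      then show ?thesis by simp
    qed
    \<comment> \<open>Absolute convergence over all naturals restricts to smooth numbers and
      transfers to pairs, which justifies summing iteratedly.\<close>
    have "?r summable_on UNIV"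
      using summable_abs_cdeg_moebius by (intro norm_summable_imp_summable_on) simp
    then have "?r summable_on smooth_numbers ?p" by (rule summable_on_subset_banach) simp
    then have sm: "(?r \<circ> ?h) summable_on smooth_numbers k \<times> UNIV"
      using bij by (simp add: bij_betw_def flip: summable_on_reindex)
    have "summable (\<lambda>a. norm (?r (?p ^ a)))"
      using summable_abs_cdeg_moebius_prime_powers[OF True] by (simp only: real_norm_def)
    then have loc: "((\<lambda>a. ?r (?p ^ a)) has_sum local_factor ?p) UNIV"
      by (rule norm_summable_imp_has_sum[OF _ local_factor_sums[OF True]])
    have "((?r \<circ> ?h) has_sum ((\<Prod>i\<le>k. euler_factor i) * local_factor ?p)) (smooth_numbers k \<times> UNIV)"
    proof (rule has_sum_SigmaI[OF _ _ sm])
      show "((\<lambda>m. ?r m * local_factor ?p) has_sum (\<Prod>i\<le>k. euler_factor i) * local_factor ?p) (smooth_numbers k)"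
        by (rule has_sum_cmult_left[OF Suc])
      show "((\<lambda>a. (?r \<circ> ?h) (m, a)) has_sum ?r m * local_factor ?p) UNIV" if "m \<in> smooth_numbers k" for m
        unfolding r[OF that] by (rule has_sum_cmult_right[OF loc])
    qed
    then have "(?r has_sum ((\<Prod>i\<le>k. euler_factor i) * local_factor ?p)) (smooth_numbers ?p)"
      using bij by (simp add: bij_betw_def flip: has_sum_reindex)
    then show ?thesis using True by (simp add: euler_factor_def)
  qed
qed

text \<open>Partial Euler products are sums of \<open>?r\<close> masked by smoothness. Each mask is
  eventually trivial and the absolute values dominate, so Tannery's theorem identifies the limit
  with the full series.\<close>

lemma mean_const_eq: "mean_const = cdeg_moebius_series"
proof -
  let ?r = "\<lambda>n. cdeg_moebius n / real n"
  define a where "a = (\<lambda>n k. if n \<in> smooth_numbers k then ?r n else 0)"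
  have "(\<lambda>n. a n k) sums (\<Prod>i\<le>k. euler_factor i)" for k
  proof -
    have "((\<lambda>n. a n k) has_sum (\<Prod>i\<le>k. euler_factor i)) UNIV"
      using has_sum_smooth_numbers[of k]
      by (subst has_sum_cong_neutral[of "smooth_numbers k" _ ?r]) (auto simp: a_def)
    then show ?thesis by (rule has_sum_imp_sums)
  qed
  then have suminf_a: "(\<Sum>n. a n k) = (\<Prod>i\<le>k. euler_factor i)" for k
    by (simp add: sums_iff)
  have "(\<lambda>k. \<Sum>n. a n k) \<longlonglongrightarrow> (\<Sum>n. ?r n)"
  proof (rule tannerys_theorem[where M = "\<lambda>n. \<bar>?r n\<bar>", THEN conjunct2, THEN conjunct2])
    show "(\<lambda>k. a n k) \<longlonglongrightarrow> ?r n" for n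
    proof (rule tendsto_eventually, rule eventually_sequentiallyI)
      fix k assume "n \<le> k"
      \<comment> \<open>Every positive \<open>n\<close> up to \<open>k\<close> has only prime
        divisors up to \<open>k\<close>; at \<open>n = 0\<close> both sides are 0.\<close>
      then show "a n k = ?r n"
        by (cases "n = 0") (auto simp: a_def smooth_numbers_def dest!: dvd_imp_le)
    qed
    show "\<forall>\<^sub>F (n, k) in sequentially \<times>\<^sub>F sequentially. norm (a n k) \<le> \<bar>?r n\<bar>"
      by (rule always_eventually) (auto simp: a_def)
  qed (use summable_abs_cdeg_moebius in auto)
  moreover have "(\<lambda>k. \<Sum>n. a n k) \<longlonglongrightarrow> mean_const"
    unfolding suminf_a mean_const_def by (rule convergent_prod_LIMSEQ[OF convergent_prod_euler_factor])
  ultimately show ?thesis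
    unfolding cdeg_moebius_series_def by (rule LIMSEQ_unique[symmetric])
qed

section \<open>The asymptotic formula for real arguments\<close>

theorem theorem3p1p3:
  shows "(\<forall>p::nat. prime p \<longrightarrow> summable (\<lambda>a. cdeg_square (p ^ a) / real (p ^ a)))
    \<and> convergent_prod euler_factor
    \<and> (\<lambda>x::real. (\<Sum>n | 0 < n \<and> real n \<le> x. cdeg (integer_mod_group n \<times>\<times> integer_mod_group n))
          - mean_const * x) \<in> O[at_top](\<lambda>x. (ln x) ^ 3)"
proof (intro conjI allI impI)
  \<comment> \<open>For \<open>x >= exp 1\<close> one has \<open>1 + ln N <= 2 * ln x\<close>, and
    cubing gives the 8. The last summand absorbs the error below
    \<open>\<bar>mean_const\<bar>\<close> or equal to it that comes from replacing \<open>N\<close>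
    by \<open>x\<close>.\<close>
  define K where "K = 8 * (1 + tail_const + \<bar>mean_const\<bar>)"
  have "eventually (\<lambda>x. norm ((\<Sum>n | 0 < n \<and> real n \<le> x. cdeg (Z_square n)) - mean_const * x)
      \<le> K * norm ((ln x) ^ 3)) at_top"
    using eventually_ge_at_top[of "exp 1 :: real"]
  proof eventually_elim
    case (elim x)
    have x1: "x \<ge> 1" using elim exp_ge_add_one_self[of 1] by linarith
    have lnx: "ln x \<ge> 1" using elim x1 by (subst ln_ge_iff) auto
    define N where "N = nat \<lfloor>x\<rfloor>"
    have N: "real N \<le> x" "x < real N + 1" "N > 0"
      using x1 by (auto simp: N_def le_nat_floor)
    have "{n. 0 < n \<and> real n \<le> x} = {1..N}"
      using x1 by (auto simp: N_def le_nat_floor le_nat_iff le_floor_iff)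
    then have "(\<Sum>n | 0 < n \<and> real n \<le> x. cdeg (Z_square n)) = (\<Sum>n\<in>{1..N}. cdeg_square n)"
      by (simp add: cdeg_square_def)
    moreover have "\<bar>(\<Sum>n\<in>{1..N}. cdeg_square n) - mean_const * real N\<bar> \<le> (1 + tail_const) * (1 + ln (real N)) ^ 3"
      using sum_cdeg_square_nat[OF N(3)] by (simp add: mean_const_eq)
    moreover have "\<bar>mean_const * real N - mean_const * x\<bar> \<le> \<bar>mean_const\<bar>"
    proof -
      have "\<bar>mean_const * real N - mean_const * x\<bar> = \<bar>mean_const\<bar> * \<bar>real N - x\<bar>"
        by (simp add: abs_mult flip: right_diff_distrib)
      also have "\<dots> \<le> \<bar>mean_const\<bar> * 1" using N by (intro mult_left_mono) auto
      finally show ?thesis by simp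
    qed
    moreover have "(1 + tail_const) * (1 + ln (real N)) ^ 3 \<le> (1 + tail_const) * (2 * ln x) ^ 3"
    proof (intro mult_left_mono power_mono)
      have "ln (real N) \<le> ln x" using N by (simp add: ln_le_cancel_iff)
      then show "1 + ln (real N) \<le> 2 * ln x" using lnx by linarith
    qed (use N tail_const_nonneg in auto)
    moreover have "\<bar>mean_const\<bar> * 1 \<le> \<bar>mean_const\<bar> * (8 * ln x ^ 3)"
    proof (intro mult_left_mono)
      have "1 \<le> ln x ^ 3" using lnx by (rule one_le_power)
      then show "1 \<le> 8 * ln x ^ 3" by simp
    qed simp
    ultimately have "\<bar>(\<Sum>n | 0 < n \<and> real n \<le> x. cdeg (Z_square n)) - mean_const * x\<bar>
        \<le> (1 + tail_const) * (2 * ln x) ^ 3 + \<bar>mean_const\<bar> * (8 * ln x ^ 3)"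
      by linarith
    also have "\<dots> = K * norm (ln x ^ 3)"
      using lnx by (simp add: K_def algebra_simps power_mult_distrib)
    finally show ?case by simp
  qed
  then show "(\<lambda>x::real. (\<Sum>n | 0 < n \<and> real n \<le> x. cdeg (integer_mod_group n \<times>\<times> integer_mod_group n))
          - mean_const * x) \<in> O[at_top](\<lambda>x. (ln x) ^ 3)"
    by (rule landau_o.bigI[rotated]) (use tail_const_nonneg in \<open>simp add: K_def add_pos_nonneg\<close>)
\<comment> \<open>The other two conjuncts ensure that the series and the product behind
  \<open>mean_const\<close> converge, so their values are genuine limits.\<close>
qed (fact summable_cdeg_square_prime_powers convergent_prod_euler_factor)+

end
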